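(* The function $\mathbf{Q}\mapsto\bar I(\mathbf{Q})$ is strictly concave on $\mathcal{C}_1$.
   Context: Let $r,t\ge1$ be integers, $\sigma^2>0$, $K\ge0$. Let $\mathbf{A}$ be a deterministic $r\times t$ complex matrix with $\frac1r\mathrm{Tr}(\mathbf{A}\mathbf{A}^H)=1$, and $\mathbf{C}>0$ ($r\times r$), $\tilde{\mathbf{C}}>0$ ($t\times t$) Hermitian positive definite matrices with $\frac1r\mathrm{Tr}\,\mathbf{C}=1$, $\frac1t\mathrm{Tr}\,\tilde{\mathbf{C}}=1$. $\mathcal{C}_1$ is the set of nonnegative Hermitian $t\times t$ matrices $\mathbf{Q}$ with $\frac1t\mathrm{Tr}(\mathbf{Q})=1$. For $\mathbf{Q}\in\mathcal{C}_1$, $(\delta,\tilde\delta)=(\delta(\mathbf{Q}),\tilde\delta(\mathbf{Q}))$ is the unique strictly positive solution of the system $$\delta=\tfrac1t\mathrm{Tr}\left\{\mathbf{C}\left[\sigma^2\left(\mathbf{I}_r+\tfrac{\tilde\delta}{K+1}\mathbf{C}\right)+\tfrac{K}{K+1}\mathbf{A}\mathbf{Q}^{1/2}\left(\mathbf{I}_t+\tfrac{\delta}{K+1}\mathbf{Q}^{1/2}\tilde{\mathbf{C}}\mathbf{Q}^{1/2}\right)^{-1}\mathbf{Q}^{1/2}\mathbf{A}^H\right]^{-1}\right\},$$ $$\tilde\delta=\tfrac1t\mathrm{Tr}\left\{\mathbf{Q}^{1/2}\tilde{\mathbf{C}}\mathbf{Q}^{1/2}\left[\sigma^2\left(\mathbf{I}_t+\tfrac{\delta}{K+1}\mathbf{Q}^{1/2}\tilde{\mathbf{C}}\mathbf{Q}^{1/2}\right)+\tfrac{K}{K+1}\mathbf{Q}^{1/2}\mathbf{A}^H\left(\mathbf{I}_r+\tfrac{\tilde\delta}{K+1}\mathbf{C}\right)^{-1}\mathbf{A}\mathbf{Q}^{1/2}\right]^{-1}\right\},$$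 and $$\bar I(\mathbf{Q})=\log\det\left(\mathbf{I}_t+\tfrac{\delta(\mathbf{Q})}{K+1}\mathbf{Q}^{1/2}\tilde{\mathbf{C}}\mathbf{Q}^{1/2}+\tfrac{1}{\sigma^2}\tfrac{K}{K+1}\mathbf{Q}^{1/2}\mathbf{A}^H\left(\mathbf{I}_r+\tfrac{\tilde\delta(\mathbf{Q})}{K+1}\mathbf{C}\right)^{-1}\mathbf{A}\mathbf{Q}^{1/2}\right)+\log\det\left(\mathbf{I}_r+\tfrac{\tilde\delta(\mathbf{Q})}{K+1}\mathbf{C}\right)-\tfrac{t\sigma^2}{K+1}\delta(\mathbf{Q})\tilde\delta(\mathbf{Q}).$$ *)

theory Defs
  imports "HOL-Analysis.Analysis"
begin

definition ctranspose :: "complex^'n^'m \<Rightarrow> complex^'m^'n"  ("_\<^sup>H" [1000] 999)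
  where "M\<^sup>H = (\<chi> i j. cnj (M $ j $ i))"

definition hermitian :: "complex^'n^'n \<Rightarrow> bool"
  where "hermitian M \<longleftrightarrow> M\<^sup>H = M"

(* x^H M x. It is real when M is Hermitian, so taking Re below loses nothing. *)
definition quad_form :: "complex^'n^'n \<Rightarrow> complex^'n \<Rightarrow> complex"
  where "quad_form M x = (\<Sum>i\<in>UNIV. cnj (x $ i) * (M *v x) $ i)"

definition psd :: "complex^'n^'n \<Rightarrow> bool"
  where "psd M \<longleftrightarrow> hermitian M \<and> (\<forall>x. 0 \<le> Re (quad_form M x))"

definition pos_def :: "complex^'n^'n \<Rightarrow> bool"
  where "pos_def M \<longleftrightarrow> hermitian M \<and> (\<forall>x. x \<noteq> 0 \<longrightarrow> 0 < Re (quad_form M x))"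

definition psd_sqrt :: "complex^'n^'n \<Rightarrow> complex^'n^'n"
  where "psd_sqrt Q = (THE S. psd S \<and> S ** S = Q)"

definition C1 :: "(complex^'t^'t) set"
  where "C1 = {Q. psd Q \<and> trace Q / of_nat CARD('t) = 1}"

(* Used only at Hermitian positive definite matrices, whose determinant is real and positive. *)
definition log_det :: "complex^'n^'n \<Rightarrow> real"
  where "log_det M = ln (Re (det M))"

text \<open>
  Throughout, \<open>K\<close>, \<open>A\<close>, \<open>C\<close>, \<open>Ct\<close> stand for $K$, $\mathbf{A}$, $\mathbf{C}$, $\tilde{\mathbf{C}}$, and \<open>d\<close>, \<open>dt\<close> for
  $\delta$, $\tilde\delta$. The dimensions are $r = $ \<open>CARD('r)\<close> and $t = $ \<open>CARD('t)\<close>.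
\<close>

definition canonical_system ::
  "real \<Rightarrow> real \<Rightarrow> complex^'t^'r \<Rightarrow> complex^'r^'r \<Rightarrow> complex^'t^'t \<Rightarrow> complex^'t^'t
    \<Rightarrow> real \<Rightarrow> real \<Rightarrow> bool"
  where
  "canonical_system \<sigma> K A C Ct Q d dt \<longleftrightarrow>
    (let R = psd_sqrt Q in
      complex_of_real d =
        trace (C ** matrix_inv
          (\<sigma>\<^sup>2 *\<^sub>R (mat 1 + (dt / (K + 1)) *\<^sub>R C)
           + (K / (K + 1)) *\<^sub>R
               (A ** R ** matrix_inv (mat 1 + (d / (K + 1)) *\<^sub>R (R ** Ct ** R)) ** R ** A\<^sup>H)))
        / of_nat CARD('t)
      \<and> complex_of_real dt =
        trace (R ** Ct ** R ** matrix_inv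
          (\<sigma>\<^sup>2 *\<^sub>R (mat 1 + (d / (K + 1)) *\<^sub>R (R ** Ct ** R))
           + (K / (K + 1)) *\<^sub>R
               (R ** A\<^sup>H ** matrix_inv (mat 1 + (dt / (K + 1)) *\<^sub>R C) ** A ** R)))
        / of_nat CARD('t))"

definition delta_pair ::
  "real \<Rightarrow> real \<Rightarrow> complex^'t^'r \<Rightarrow> complex^'r^'r \<Rightarrow> complex^'t^'t \<Rightarrow> complex^'t^'t
    \<Rightarrow> real \<times> real"
  where
  "delta_pair \<sigma> K A C Ct Q =
    (THE p. 0 < fst p \<and> 0 < snd p \<and> canonical_system \<sigma> K A C Ct Q (fst p) (snd p))"

definition I_bar ::
  "real \<Rightarrow> real \<Rightarrow> complex^'t^'r \<Rightarrow> complex^'r^'r \<Rightarrow> complex^'t^'t \<Rightarrow> complex^'t^'t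
    \<Rightarrow> real"
  where
  "I_bar \<sigma> K A C Ct Q =
    (let R = psd_sqrt Q; d = fst (delta_pair \<sigma> K A C Ct Q); dt = snd (delta_pair \<sigma> K A C Ct Q) in
      log_det (mat 1 + (d / (K + 1)) *\<^sub>R (R ** Ct ** R)
        + (1 / \<sigma>\<^sup>2 * (K / (K + 1))) *\<^sub>R
            (R ** A\<^sup>H ** matrix_inv (mat 1 + (dt / (K + 1)) *\<^sub>R C) ** A ** R))
      + log_det (mat 1 + (dt / (K + 1)) *\<^sub>R C)
      - real CARD('t) * \<sigma>\<^sup>2 / (K + 1) * d * dt)"

definition strictly_concave_on :: "'a::real_vector set \<Rightarrow> ('a \<Rightarrow> real) \<Rightarrow> bool"
  where
  "strictly_concave_on S f \<longleftrightarrow> convex S \<and>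
    (\<forall>u\<in>{0<..<1}. \<forall>x\<in>S. \<forall>y\<in>S. x \<noteq> y \<longrightarrow>
      (1 - u) * f x + u * f y < f ((1 - u) *\<^sub>R x + u *\<^sub>R y))"

end

theory Submission
  imports Defs
begin

text \<open>
  Write \<open>\<delta>t\<close> for the \<open>\<delta>\<close> with tilde. Replace \<open>\<delta>\<close> and \<open>\<delta>t\<close> by free variables \<open>\<kappa>, \<kappa>t > 0\<close> in the formula for the mutual information
  and call the result \<open>V(\<kappa>, \<kappa>t, Q)\<close>. It has the form \<open>energy - \<tau> \<kappa> \<kappa>t\<close> with \<open>\<tau> = t \<sigma>\<^sup>2 / (K + 1)\<close>, where
  the energy is the logarithm of the determinant of the block matrix with diagonal blocks
  \<open>1 + \<kappa> P\<close>, \<open>1 + \<kappa>t N\<close> and off-diagonal blocks \<open>-B\<^sup>H\<close>, \<open>B\<close>, and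
  \<open>P = R Ct R / (K + 1)\<close>, \<open>N = C / (K + 1)\<close>, \<open>B\<close> is a multiple of \<open>A R\<close>, \<open>R\<close> is the square root of \<open>Q\<close>.
  The canonical system says that \<open>(\<delta>(Q), \<delta>t(Q))\<close> is a critical point of \<open>V\<close> in \<open>(\<kappa>, \<kappa>t)\<close>.
  This critical point is a saddle, and the proof uses two of its features.

  \<^item> \<open>V\<close> is concave in each of the two variables separately. So for fixed \<open>\<kappa> = \<delta>(Q)\<close> the value at the
    critical point is the maximum over \<open>\<kappa>t\<close> (lemma \<open>stationary_max\<close>).
  \<^item> On the hyperbola of constant product \<open>\<kappa> \<kappa>t\<close> through the critical point, the value there is the
    minimum (lemma \<open>energy_hyperbola\<close>). Indeed the derivative of the energy along the hyperbola with respect to \<open>ln \<kappa>\<close> is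
    \<open>\<kappa> tr(X\<^sup>-\<^sup>1 P) - \<kappa>t tr(Z\<^sup>-\<^sup>1 N)\<close> with \<open>X, Z\<close> the two Schur complements. It vanishes at the critical
    point, and it increases with \<open>\<kappa>\<close> because inversion reverses the order of positive definite matrices.

  For fixed \<open>\<kappa> > 0\<close>, moreover, \<open>V\<close> is jointly concave in \<open>(\<kappa>t, Q)\<close>, and strictly so between two different \<open>Q\<close>
  (lemma \<open>energy_strictly_concave\<close>): \<open>V\<close> depends on \<open>Q\<close> through \<open>log det(F + Q)\<close>, with \<open>F\<close> a multiple of
  the inverse of \<open>Ct\<close>, and through the parallel sum of \<open>F\<close> and \<open>Q\<close>, which is a concave matrix function.

  Now let \<open>Q0 = (1 - u) Q1 + u Q2\<close> have the critical point \<open>(\<kappa>, \<kappa>t)\<close>. Sliding the critical point of each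
  \<open>Qi\<close> along its hyperbola to the abscissa \<open>\<kappa>\<close> gives a point \<open>(\<kappa>, ki)\<close> at which \<open>V\<close> is at least
  the mutual information of \<open>Qi\<close>. Strict joint concavity bounds the convex combination of these two values
  strictly by \<open>V(\<kappa>, (1 - u) k1 + u k2, Q0)\<close>, and maximality in \<open>\<kappa>t\<close> bounds this by the mutual information
  of \<open>Q0\<close>.

  The same two features show that the critical point is unique (\<open>stationary_unique\<close>), and Brouwer's fixed
  point theorem gives its existence (\<open>stationary_exists\<close>). No derivatives are taken: the tangent inequality
  \<open>log det Y - log det X \<le> tr(X\<^sup>-\<^sup>1 (Y - X))\<close> (\<open>log_det_tangent\<close>) takes their place.
\<close>

section \<open>Matrix algebra, adjoints and definite matrices\<close>

lemma matrix_add_rdist: "(A + B) ** C = A ** C + B ** (C :: complex^'n^'m)"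
  by (vector matrix_matrix_mult_def sum.distrib[symmetric] field_simps)

lemma matrix_diff_ldist: "A ** (B - C) = A ** B - A ** (C :: complex^'n^'m)"
  by (vector matrix_matrix_mult_def sum_subtractf[symmetric] field_simps)

lemma matrix_diff_rdist: "(A - B) ** C = A ** C - B ** (C :: complex^'n^'m)"
  by (vector matrix_matrix_mult_def sum_subtractf[symmetric] field_simps)

lemma matrix_scaleR_left: "(k *\<^sub>R A) ** B = k *\<^sub>R (A ** (B :: complex^'n^'m))"
  by (simp add: scalar_matrix_assoc)

lemma matrix_scaleR_right: "A ** (k *\<^sub>R B) = k *\<^sub>R (A ** (B :: complex^'n^'m))"
  by (simp add: matrix_scalar_ac scalar_matrix_assoc)

lemmas mat_distribs = matrix_add_ldistrib matrix_add_rdist matrix_diff_ldist matrix_diff_rdist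
  matrix_scaleR_left matrix_scaleR_right matrix_mul_assoc

lemma scaleR_matrix_vector: "(k *\<^sub>R A) *v x = k *\<^sub>R (A *v (x :: complex^'n))"
  by (simp add: matrix_vector_mult_def vec_eq_iff scaleR_sum_right)

lemma matrix_vector_scaleR: "M *v (k *\<^sub>R x) = k *\<^sub>R (M *v (x :: complex^'n))"
  by (simp add: matrix_vector_mult_def vec_eq_iff scaleR_sum_right)

lemma trace_scaleR: "trace (k *\<^sub>R (A :: complex^'n^'n)) = k *\<^sub>R trace A"
  by (simp add: trace_def scaleR_sum_right)

lemma ctranspose_mult: "(A ** B)\<^sup>H = B\<^sup>H ** A\<^sup>H"
  by (simp add: ctranspose_def matrix_matrix_mult_def vec_eq_iff mult.commute)

lemma ctranspose_simps [simp]: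
  "(A + B)\<^sup>H = A\<^sup>H + B\<^sup>H" "(A - B)\<^sup>H = A\<^sup>H - B\<^sup>H" "(k *\<^sub>R A)\<^sup>H = k *\<^sub>R A\<^sup>H"
  "(A\<^sup>H)\<^sup>H = A" "0\<^sup>H = 0"
  by (simp_all add: ctranspose_def vec_eq_iff)

lemma ctranspose_mat_1 [simp]: "(mat 1)\<^sup>H = mat 1"
  by (auto simp: ctranspose_def vec_eq_iff mat_def)

text \<open>The real inner product of \<open>complex^'n\<close> is the real part of the Hermitian one. This makes the lemmas on
  real inner products available for quadratic forms (\<open>Re_quad_form\<close>).\<close>

lemma inner_adjoint: "x \<bullet> (M *v y) = (M\<^sup>H *v x) \<bullet> (y :: complex^'n)"
proof -
  have "x \<bullet> (M *v y) = (\<Sum>i\<in>UNIV. \<Sum>j\<in>UNIV. x$i \<bullet> (M$i$j * y$j))"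
    by (simp add: inner_vec_def matrix_vector_mult_def inner_sum_right)
  also have "\<dots> = (\<Sum>j\<in>UNIV. \<Sum>i\<in>UNIV. (cnj (M$i$j) * x$i) \<bullet> y$j)"
    by (subst sum.swap) (simp add: inner_complex_def algebra_simps)
  also have "\<dots> = (M\<^sup>H *v x) \<bullet> y"
    by (simp add: inner_vec_def matrix_vector_mult_def inner_sum_left ctranspose_def)
  finally show ?thesis .
qed

lemma Re_quad_form: "Re (quad_form M x) = x \<bullet> (M *v x)"
  by (simp add: quad_form_def inner_vec_def inner_complex_def)

lemma psd_iff: "psd M \<longleftrightarrow> M\<^sup>H = M \<and> (\<forall>x. 0 \<le> x \<bullet> (M *v x))"
  by (simp add: psd_def hermitian_def Re_quad_form)

lemma pos_def_iff: "pos_def M \<longleftrightarrow> M\<^sup>H = M \<and> (\<forall>x. x \<noteq> 0 \<longrightarrow> 0 < x \<bullet> (M *v x))"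
  by (simp add: pos_def_def hermitian_def Re_quad_form)

lemma pos_def_imp_psd: "pos_def M \<Longrightarrow> psd M"
  unfolding psd_iff pos_def_iff by (metis inner_zero_left less_eq_real_def)

lemma psd_ctranspose: "psd M \<Longrightarrow> M\<^sup>H = M"
  by (simp add: psd_iff)

lemma pos_def_ctranspose: "pos_def M \<Longrightarrow> M\<^sup>H = M"
  by (simp add: pos_def_iff)

lemma psd_add: "psd M \<Longrightarrow> psd N \<Longrightarrow> psd (M + N)"
  by (simp add: psd_iff matrix_vector_mult_add_rdistrib inner_add_right)

lemma psd_scaleR: "psd M \<Longrightarrow> 0 \<le> k \<Longrightarrow> psd (k *\<^sub>R M)"
  by (simp add: psd_iff scaleR_matrix_vector)

lemma psd_zero: "psd 0"
  by (simp add: psd_iff)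

lemma pos_def_add: "pos_def M \<Longrightarrow> psd N \<Longrightarrow> pos_def (M + N)"
  by (simp add: pos_def_iff psd_iff matrix_vector_mult_add_rdistrib inner_add_right add_pos_nonneg)

lemma pos_def_scaleR: "pos_def M \<Longrightarrow> 0 < k \<Longrightarrow> pos_def (k *\<^sub>R M)"
  by (simp add: pos_def_iff scaleR_matrix_vector)

lemma pos_def_mat_1: "pos_def (mat 1)"
  by (simp add: pos_def_iff)

lemma psd_congruence: "psd M \<Longrightarrow> psd (V\<^sup>H ** M ** V)"
  unfolding psd_iff
  by (metis (no_types, lifting) ctranspose_mult ctranspose_simps(4) inner_adjoint matrix_mul_assoc matrix_vector_mul_assoc)

lemma inner_congruence: "x \<bullet> ((V\<^sup>H ** M ** V) *v x) = (V *v x) \<bullet> (M *v (V *v x))"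
  by (metis (no_types, lifting) ctranspose_simps(4) inner_adjoint matrix_vector_mul_assoc)

lemma pos_def_congruence:
  fixes V :: "complex^'n^'n"
  assumes "pos_def M" "invertible V"
  shows "pos_def (V\<^sup>H ** M ** V)"
proof -
  have "V *v x \<noteq> 0" if "x \<noteq> 0" for x
    using that assms(2) by (metis inj_matrix_vector_mult injD matrix_vector_mult_0_right)
  then show ?thesis
    using assms(1) by (simp add: pos_def_iff inner_congruence ctranspose_mult matrix_mul_assoc)
qed

lemma matrix_inv_mult:
  assumes "invertible (M :: complex^'n^'n)"
  shows "M ** matrix_inv M = mat 1" "matrix_inv M ** M = mat 1"
  using assms unfolding invertible_def matrix_inv_def
  by (metis (mono_tags, lifting) someI_ex)+

lemma matrix_inv_eqI: "M ** N = mat 1 \<Longrightarrow> matrix_inv M = (N :: complex^'n^'n)"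
  by (metis invertible_right_inverse matrix_inv_mult(2) matrix_mul_assoc matrix_mul_lid matrix_mul_rid)

lemma pos_def_invertible: "pos_def M \<Longrightarrow> invertible M"
  unfolding invertible_left_inverse matrix_left_invertible_ker pos_def_iff
  by (metis inner_zero_right less_irrefl)

lemma ctranspose_inv:
  assumes "invertible (M :: complex^'n^'n)" shows "(matrix_inv M)\<^sup>H = matrix_inv (M\<^sup>H)"
  by (rule matrix_inv_eqI[symmetric])
    (metis assms ctranspose_mult ctranspose_mat_1 matrix_inv_mult(2))

lemma pos_def_inv:
  assumes "pos_def M" shows "pos_def (matrix_inv M)"
proof -
  have i: "invertible M" and h: "(matrix_inv M)\<^sup>H = matrix_inv M"
    using assms ctranspose_inv pos_def_ctranspose pos_def_invertible by metis+
  have "invertible (matrix_inv M)"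
    using matrix_inv_mult[OF i] invertible_def by blast
  from pos_def_congruence[OF assms this] show ?thesis
    by (simp add: h matrix_inv_mult[OF i])
qed

section \<open>Diagonalization of Hermitian matrices\<close>

text \<open>Orthonormality of eigenvectors over the complex numbers is stronger than orthogonality for the real inner
  product, so the Hermitian form itself is needed for diagonalization.\<close>

definition cinner :: "complex^'n \<Rightarrow> complex^'n \<Rightarrow> complex"
  where "cinner x y = (\<Sum>i\<in>UNIV. cnj (x$i) * y$i)"

definition real_diag :: "('n \<Rightarrow> real) \<Rightarrow> complex^'n^'n"
  where "real_diag d = (\<chi> i j. if i = j then of_real (d i) else 0)"

lemma cinner_adjoint: "cinner x (M *v y) = cinner (M\<^sup>H *v x) y"
proof -
  have "cinner x (M *v y) = (\<Sum>i\<in>UNIV. \<Sum>j\<in>UNIV. cnj (x$i) * (M$i$j * y$j))"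
    by (simp add: cinner_def matrix_vector_mult_def sum_distrib_left)
  also have "\<dots> = cinner (M\<^sup>H *v x) y"
    by (subst sum.swap)
      (simp add: cinner_def matrix_vector_mult_def sum_distrib_left sum_distrib_right ctranspose_def ac_simps)
  finally show ?thesis .
qed

lemma cinner_simps:
  "cinner x (y + z) = cinner x y + cinner x z"
  "cinner x (y - z) = cinner x y - cinner x z"
  "cinner x (k *\<^sub>R y) = k *\<^sub>R cinner x y"
  "cinner (k *\<^sub>R x) y = k *\<^sub>R cinner x y"
  by (simp_all add: cinner_def algebra_simps sum.distrib sum_subtractf scaleR_sum_right)

lemma cinner_commute: "cinner y x = cnj (cinner x y)"
  by (simp add: cinner_def mult.commute)

lemma cinner_self: "cinner x x = of_real ((norm x)\<^sup>2)"
proof -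
  have "Re (cinner x x) = x \<bullet> x"
    by (simp add: cinner_def inner_vec_def inner_complex_def)
  moreover have "Im (cinner x x) = 0"
    by (simp add: cinner_def)
  ultimately show ?thesis
    by (simp add: complex_eq_iff power2_norm_eq_inner)
qed

text \<open>First-order condition at a maximum: near \<open>s = 0\<close> the linear term dominates.\<close>

lemma quadratic_nonpos_imp_linear_zero:
  fixes a b :: real
  assumes "\<And>s. 2 * s * a + s\<^sup>2 * b \<le> 0"
  shows "a = 0"
proof (rule ccontr)
  assume "a \<noteq> 0"
  define p where "p = \<bar>b\<bar> + 1"
  have "p > 0" "2 * p + b > 0"
    by (auto simp: p_def)
  have "2 * (a / p) * a + (a / p)\<^sup>2 * b = a\<^sup>2 * (2 * p + b) / p\<^sup>2"
    using \<open>p > 0\<close> by (simp add: field_simps power2_eq_square)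
  also have "\<dots> > 0"
    using \<open>p > 0\<close> \<open>2 * p + b > 0\<close> \<open>a \<noteq> 0\<close> by simp
  finally show False
    using assms[of "a / p"] by linarith
qed

text \<open>Induction step of the spectral theorem. The orthogonal complement \<open>W\<close> of the eigenvectors found so far is
  invariant under \<open>M\<close>, and a maximizer of the Rayleigh quotient on the unit sphere of \<open>W\<close> is an eigenvector.
  That \<open>W\<close> is not zero follows from a matrix with a zero row having a nontrivial kernel, where the index
  \<open>k \<notin> S\<close> supplies the zero row.\<close>

lemma eigenvector_in_complement:
  fixes M :: "complex^'n^'n" and v :: "'n \<Rightarrow> complex^'n" and S :: "'n set"
  assumes herm: "M\<^sup>H = M" and "k \<notin> S"
    and eig: "\<And>i. i \<in> S \<Longrightarrow> M *v v i = d i *\<^sub>R v i"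
  obtains x \<mu> where "M *v x = \<mu> *\<^sub>R x" "norm x = 1" "\<And>i. i \<in> S \<Longrightarrow> cinner (v i) x = 0"
proof -
  \<comment> \<open>The kernel of \<open>B\<close> is \<open>W\<close>, and row \<open>k\<close> of \<open>B\<close> is zero.\<close>
  define W where "W = {x. \<forall>i\<in>S. cinner (v i) x = 0}"
  define B :: "complex^'n^'n" where "B = (\<chi> i j. if i \<in> S then cnj (v i $ j) else 0)"
  have B: "(B *v x) $ i = (if i \<in> S then cinner (v i) x else 0)" for x i
    by (simp add: B_def matrix_vector_mult_def cinner_def)
  have "row k B = 0"
    using \<open>k \<notin> S\<close> by (simp add: row_def B_def vec_eq_iff)
  then have "det B = 0"
    by (rule det_zero_row)
  then obtain y where y: "y \<noteq> 0" "B *v y = 0"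
    by (metis invertible_det_nz invertible_left_inverse matrix_left_invertible_ker)
  have "y \<in> W"
    unfolding W_def
  proof (intro CollectI ballI)
    fix i assume "i \<in> S"
    then have "cinner (v i) y = (B *v y) $ i" by (simp add: B)
    then show "cinner (v i) y = 0" by (simp add: y(2))
  qed
  have W_scale: "k *\<^sub>R x \<in> W" if "x \<in> W" for k x
    using that by (simp add: W_def cinner_simps)
  have W_add: "x + z \<in> W" if "x \<in> W" "z \<in> W" for x z
    using that by (simp add: W_def cinner_simps)
  have W_M: "M *v x \<in> W" if "x \<in> W" for x
    using that by (simp add: W_def cinner_adjoint herm eig cinner_simps)
  have "W = {x. B *v x = 0}"
    using B by (auto simp: W_def vec_eq_iff)
  moreover have contM: "continuous_on A (\<lambda>x. M' *v x)" for A and M' :: "complex^'n^'n"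
    by (intro linear_continuous_on matrix_vector_mul_bounded_linear)
  ultimately have "closed W"
    by (simp add: closed_Collect_eq contM)
  then have "compact (sphere 0 1 \<inter> W)"
    by (intro compact_Int_closed compact_sphere)
  moreover have "(1 / norm y) *\<^sub>R y \<in> sphere 0 1 \<inter> W"
    using W_scale \<open>y \<in> W\<close> y(1) by simp
  moreover have "continuous_on (sphere 0 1 \<inter> W) (\<lambda>x. x \<bullet> (M *v x))"
    by (intro continuous_on_inner continuous_on_id contM)
  ultimately obtain x where x: "x \<in> sphere 0 1 \<inter> W"
    and max: "\<And>z. z \<in> sphere 0 1 \<inter> W \<Longrightarrow> z \<bullet> (M *v z) \<le> x \<bullet> (M *v x)"
    using continuous_attains_sup[of "sphere 0 1 \<inter> W" "\<lambda>x. x \<bullet> (M *v x)"] by blast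
  define \<mu> where "\<mu> = x \<bullet> (M *v x)"
  have xx: "x \<bullet> x = 1" and "x \<in> W"
    using x by (auto simp: norm_eq_1)
  have le: "z \<bullet> (M *v z) \<le> \<mu> * (z \<bullet> z)" if "z \<in> W" for z
  proof (cases "z = 0")
    case False
    then have "(1 / norm z) *\<^sub>R z \<in> sphere 0 1 \<inter> W"
      using W_scale that by simp
    from max[OF this] have "(z \<bullet> (M *v z)) / (norm z)\<^sup>2 \<le> \<mu>"
      by (simp add: \<mu>_def matrix_vector_scaleR power2_eq_square)
    with False show ?thesis
      by (simp add: divide_le_eq power2_norm_eq_inner[symmetric])
  qed simp
  define w where "w = M *v x - \<mu> *\<^sub>R x"
  have "w \<in> W"
    using W_add[OF W_M[OF \<open>x \<in> W\<close>] W_scale[OF \<open>x \<in> W\<close>, of "-\<mu>"]] by (simp add: w_def)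
  \<comment> \<open>Maximality of the Rayleigh quotient at \<open>x\<close>, tested along the line \<open>x + s w\<close> in \<open>W\<close>.\<close>
  have "2 * s * (w \<bullet> w) + s\<^sup>2 * (w \<bullet> (M *v w) - \<mu> * (w \<bullet> w)) \<le> 0" for s
  proof -
    have "x + s *\<^sub>R w \<in> W"
      using W_add W_scale \<open>x \<in> W\<close> \<open>w \<in> W\<close> by blast
    from le[OF this] have *: "(x + s *\<^sub>R w) \<bullet> (M *v (x + s *\<^sub>R w)) \<le> \<mu> * ((x + s *\<^sub>R w) \<bullet> (x + s *\<^sub>R w))" .
    have "x \<bullet> (M *v w) = w \<bullet> (M *v x)"
      by (metis herm inner_adjoint inner_commute)
    then have e1: "(x + s *\<^sub>R w) \<bullet> (M *v (x + s *\<^sub>R w)) = \<mu> + 2 * s * (w \<bullet> (M *v x)) + s\<^sup>2 * (w \<bullet> (M *v w))"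
      by (simp add: matrix_vector_right_distrib matrix_vector_scaleR inner_add_left
          inner_add_right \<mu>_def power2_eq_square algebra_simps)
    have e2: "(x + s *\<^sub>R w) \<bullet> (x + s *\<^sub>R w) = 1 + 2 * s * (w \<bullet> x) + s\<^sup>2 * (w \<bullet> w)"
      by (simp add: xx inner_add_left inner_add_right inner_commute power2_eq_square algebra_simps)
    have "w \<bullet> w = w \<bullet> (M *v x) - \<mu> * (w \<bullet> x)"
      by (metis inner_diff_right inner_scaleR_right w_def)
    then have "2 * s * (w \<bullet> w) = 2 * s * (w \<bullet> (M *v x)) - \<mu> * (2 * s * (w \<bullet> x))"
      by (simp only: right_diff_distrib ac_simps)
    then show ?thesis
      using *[unfolded e1 e2] unfolding distrib_left right_diff_distrib by (simp add: ac_simps)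
  qed
  then have "w \<bullet> w = 0"
    by (rule quadratic_nonpos_imp_linear_zero)
  then have "M *v x = \<mu> *\<^sub>R x"
    by (simp add: w_def)
  then show ?thesis
    using that x by (auto simp: W_def)
qed

lemma orthonormal_eigenvectors:
  fixes M :: "complex^'n^'n" and S :: "'n set"
  assumes "M\<^sup>H = M"
  shows "\<exists>(v :: 'n \<Rightarrow> complex^'n) (d :: 'n \<Rightarrow> real).
    \<forall>i\<in>S. M *v v i = d i *\<^sub>R v i \<and> (\<forall>j\<in>S. cinner (v i) (v j) = (if i = j then 1 else 0))"
  using finite[of S]
proof induction
  case (insert k S)
  then obtain v d where vd: "\<And>i. i \<in> S \<Longrightarrow> M *v v i = d i *\<^sub>R v i"
    "\<And>i j. i \<in> S \<Longrightarrow> j \<in> S \<Longrightarrow> cinner (v i) (v j) = (if i = j then 1 else 0)"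
    by metis
  obtain x \<mu> where x: "M *v x = \<mu> *\<^sub>R x" "norm x = 1" "\<And>i. i \<in> S \<Longrightarrow> cinner (v i) x = 0"
    using eigenvector_in_complement[of M k S v d] assms insert.hyps(2) vd(1) by blast
  then have "\<And>i. i \<in> S \<Longrightarrow> cinner x (v i) = 0"
    by (metis cinner_commute complex_cnj_zero)
  moreover have "cinner x x = 1"
    using x(2) by (simp add: cinner_self)
  ultimately show ?case
    using x vd insert.hyps(2)
    by (intro exI[of _ "v(k := x)"] exI[of _ "d(k := \<mu>)"]) auto
qed simp

theorem hermitian_diagonalization:
  fixes M :: "complex^'n^'n"
  assumes "M\<^sup>H = M"
  obtains U :: "complex^'n^'n" and d :: "'n \<Rightarrow> real" where "U\<^sup>H ** U = mat 1" "U ** U\<^sup>H = mat 1"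
    "M = U ** real_diag d ** U\<^sup>H"
proof -
  obtain v :: "'n \<Rightarrow> complex^'n" and d :: "'n \<Rightarrow> real" where eig: "\<And>i. M *v v i = d i *\<^sub>R v i"
    and orth: "\<And>i j. cinner (v i) (v j) = (if i = j then 1 else 0)"
    using orthonormal_eigenvectors[OF assms, of UNIV] by blast
  define U :: "complex^'n^'n" where "U = (\<chi> i j. v j $ i)"
  have 1: "U\<^sup>H ** U = mat 1"
    using orth by (simp add: vec_eq_iff U_def ctranspose_def matrix_matrix_mult_def mat_def cinner_def)
  then have 2: "U ** U\<^sup>H = mat 1"
    using matrix_left_right_inverse by blast
  have "M ** U = U ** real_diag d"
  proof -
    have "(M ** U) $ i $ j = (M *v v j) $ i" for i j
      by (simp add: U_def matrix_matrix_mult_def matrix_vector_mult_def)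
    moreover have "(U ** real_diag d) $ i $ j = (d j *\<^sub>R v j) $ i" for i j
      by (simp add: U_def matrix_matrix_mult_def real_diag_def if_distrib scaleR_conv_of_real[where 'a=complex]
          mult.commute cong: if_cong)
    ultimately show ?thesis
      by (simp add: vec_eq_iff eig)
  qed
  then have "M = U ** real_diag d ** U\<^sup>H"
    by (metis 2 matrix_mul_assoc matrix_mul_rid)
  with 1 2 that show ?thesis by blast
qed

section \<open>Square roots, traces and determinants of semidefinite matrices\<close>

lemma real_diag_mult: "real_diag d ** real_diag e = real_diag (\<lambda>i. d i * e i)"
  by (simp add: real_diag_def matrix_matrix_mult_def vec_eq_iff if_distrib[where f="\<lambda>x. _ * x"]
      if_distrib[where f="\<lambda>x. x * _"] cong: if_cong)

lemma det_real_diag: "det (real_diag d) = of_real (prod d UNIV)"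
  by (subst det_diagonal) (simp_all add: real_diag_def)

lemma trace_real_diag: "trace (real_diag d) = of_real (sum d UNIV)"
  by (simp add: trace_def real_diag_def)

lemma real_diag_vector: "real_diag d *v x = (\<chi> i. d i *\<^sub>R x $ i)"
  by (simp add: real_diag_def matrix_vector_mult_def vec_eq_iff if_distrib[where f="\<lambda>x. x * _"]
      scaleR_conv_of_real cong: if_cong)

lemma psd_real_diag:
  assumes "\<forall>i. 0 \<le> d i" shows "psd (real_diag d)"
proof -
  have "(real_diag d)\<^sup>H = real_diag d"
    by (auto simp: real_diag_def ctranspose_def vec_eq_iff)
  then show ?thesis
    using assms by (simp add: psd_iff real_diag_vector inner_vec_def sum_nonneg)
qed

lemma det_conj:
  fixes U D :: "complex^'n^'n"
  assumes "U\<^sup>H ** U = mat 1"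
  shows "det (U ** D ** U\<^sup>H) = det D"
proof -
  have "det (U\<^sup>H) * det U = 1"
    by (metis assms det_I det_mul)
  then show ?thesis
    by (simp add: det_mul ac_simps)
qed

lemma trace_conj:
  fixes U D :: "complex^'n^'n"
  assumes "U\<^sup>H ** U = mat 1"
  shows "trace (U ** D ** U\<^sup>H) = trace D"
  by (metis assms matrix_mul_assoc matrix_mul_lid trace_mul_sym)

lemma psd_diagonalization:
  fixes M :: "complex^'n^'n"
  assumes "psd M"
  obtains U :: "complex^'n^'n" and d :: "'n \<Rightarrow> real" where "U\<^sup>H ** U = mat 1" "U ** U\<^sup>H = mat 1"
    "M = U ** real_diag d ** U\<^sup>H" "\<forall>i. 0 \<le> d i"
proof -
  obtain U :: "complex^'n^'n" and d :: "'n \<Rightarrow> real" where U: "U\<^sup>H ** U = mat 1" "U ** U\<^sup>H = mat 1"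
    and M: "M = U ** real_diag d ** U\<^sup>H"
    using hermitian_diagonalization[of M] assms psd_ctranspose by blast
  have "U\<^sup>H ** M ** U = (U\<^sup>H ** U) ** real_diag d ** (U\<^sup>H ** U)"
    by (simp only: M matrix_mul_assoc)
  then have D: "real_diag d = U\<^sup>H ** M ** U"
    by (simp add: U)
  have d: "d i = (U *v axis i 1) \<bullet> (M *v (U *v axis i 1))" for i
  proof -
    have "d i = axis i 1 \<bullet> (real_diag d *v axis i (1::complex))"
      by (simp add: real_diag_vector inner_axis')
    then show ?thesis
      by (simp only: D inner_congruence)
  qed
  have "\<forall>i. 0 \<le> d i"
    using assms by (simp add: d psd_iff)
  with U M show ?thesis
    by (rule that)
qed

lemma pos_def_diagonalization:
  fixes M :: "complex^'n^'n"
  assumes "pos_def M"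
  obtains U :: "complex^'n^'n" and d :: "'n \<Rightarrow> real" where "U\<^sup>H ** U = mat 1" "U ** U\<^sup>H = mat 1"
    "M = U ** real_diag d ** U\<^sup>H" "\<forall>i. 0 < d i"
proof -
  obtain U :: "complex^'n^'n" and d :: "'n \<Rightarrow> real" where U: "U\<^sup>H ** U = mat 1" "U ** U\<^sup>H = mat 1"
    and M: "M = U ** real_diag d ** U\<^sup>H" and d: "\<forall>i. 0 \<le> d i"
    using psd_diagonalization[OF pos_def_imp_psd[OF assms]] .
  have "det M \<noteq> 0"
    using pos_def_invertible[OF assms] by (simp add: invertible_det_nz)
  then have "prod d UNIV \<noteq> 0"
    using U by (simp add: M det_conj det_real_diag del: of_real_prod)
  then have "\<forall>i. 0 < d i"
    using d by (simp add: less_le)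
  with U M show ?thesis
    by (rule that)
qed

lemma psd_sqrt_exists:
  fixes Q :: "complex^'n^'n"
  assumes "psd Q" obtains S where "psd S" "S ** S = Q"
proof -
  obtain U :: "complex^'n^'n" and d :: "'n \<Rightarrow> real" where U: "U\<^sup>H ** U = mat 1" "U ** U\<^sup>H = mat 1"
    "Q = U ** real_diag d ** U\<^sup>H" and d: "\<forall>i. 0 \<le> d i"
    using psd_diagonalization[OF assms] .
  define E where "E = real_diag (\<lambda>i. sqrt (d i))"
  have EE: "E ** E = real_diag d"
    using d by (simp add: E_def real_diag_mult)
  define S where "S = U ** E ** U\<^sup>H"
  have "psd S"
    using psd_congruence[OF psd_real_diag, of "\<lambda>i. sqrt (d i)" "U\<^sup>H"] d by (simp add: S_def E_def)
  moreover have "S ** S = U ** (E ** (U\<^sup>H ** U) ** E) ** U\<^sup>H"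
    by (simp add: S_def matrix_mul_assoc)
  then have "S ** S = Q"
    by (simp add: U EE)
  ultimately show ?thesis
    using that by blast
qed

lemma psd_trace_nonneg:
  fixes M :: "complex^'n^'n"
  assumes "psd M" shows "0 \<le> Re (trace M)"
proof -
  obtain U :: "complex^'n^'n" and d :: "'n \<Rightarrow> real" where U: "U\<^sup>H ** U = mat 1" "U ** U\<^sup>H = mat 1"
    "M = U ** real_diag d ** U\<^sup>H" and d: "\<forall>i. 0 \<le> d i"
    using psd_diagonalization[OF assms] .
  have "trace M = of_real (sum d UNIV)"
    unfolding U(3) by (simp only: trace_conj[OF U(1)] trace_real_diag)
  then show ?thesis
    using d by (simp add: sum_nonneg del: of_real_sum)
qed

lemma psd_trace_zero:
  fixes M :: "complex^'n^'n"
  assumes "psd M" "Re (trace M) = 0" shows "M = 0"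
proof -
  obtain U :: "complex^'n^'n" and d :: "'n \<Rightarrow> real" where U: "U\<^sup>H ** U = mat 1" "U ** U\<^sup>H = mat 1"
    "M = U ** real_diag d ** U\<^sup>H" and d: "\<forall>i. 0 \<le> d i"
    using psd_diagonalization[OF assms(1)] .
  have "sum d UNIV = 0"
    using assms(2) unfolding U(3) by (simp add: trace_conj[OF U(1)] trace_real_diag del: of_real_sum)
  then have "d i = 0" for i
    using d by (simp add: sum_nonneg_eq_0_iff)
  then have "real_diag d = 0"
    by (simp add: real_diag_def vec_eq_iff)
  then show ?thesis
    using U by simp
qed

lemma matrix_zero_iff: "M = 0 \<longleftrightarrow> (\<forall>x. M *v x = (0 :: complex^'n))"
  by (metis matrix_eq matrix_vector_mult_0)

lemma gram_zero:
  fixes V :: "complex^'m^'n"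
  assumes "V\<^sup>H ** V = 0" shows "V = 0"
proof -
  have "(V *v x) \<bullet> (V *v x) = 0" for x
    using inner_congruence[of x V "mat 1"] assms by simp
  then show ?thesis
    by (simp add: matrix_zero_iff)
qed

text \<open>The difference \<open>D = S - T\<close> satisfies \<open>S D + D T = 0\<close>. Multiplying by \<open>D\<close> and taking traces gives
  two nonnegative numbers with sum zero, so \<open>D S D = D T D = 0\<close> and hence \<open>D\<^sup>3 = 0\<close>; for Hermitian \<open>D\<close>
  this forces \<open>D = 0\<close>.\<close>

lemma psd_sqrt_unique:
  assumes S: "psd S" and T: "psd T" and eq: "S ** S = T ** T"
  shows "S = T"
proof -
  define D where "D = S - T"
  have D: "D\<^sup>H = D"
    using S T by (simp add: D_def psd_ctranspose)
  have "S ** D + D ** T = 0"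
    by (simp add: D_def mat_distribs eq)
  then have "D ** (S ** D + D ** T) = 0"
    by simp
  then have "Re (trace (D ** S ** D)) + Re (trace (D ** (D ** T))) = 0"
    by (metis (no_types, lifting) matrix_add_ldistrib matrix_mul_assoc plus_complex.sel(1) trace_0 mat_0
        trace_add zero_complex.sel(1))
  moreover have "trace (D ** (D ** T)) = trace (D ** T ** D)"
    by (metis trace_mul_sym)
  moreover have psd: "psd (D ** S ** D)" "psd (D ** T ** D)"
    using psd_congruence[OF S, of D] psd_congruence[OF T, of D] by (simp_all add: D)
  ultimately have "D ** S ** D = 0" "D ** T ** D = 0"
    using psd_trace_nonneg psd_trace_zero by (smt (verit))+
  then have "D ** (S - T) ** D = 0"
    by (simp add: mat_distribs)
  then have "D ** D ** D = 0"
    by (simp add: D_def)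
  then have "(D ** D)\<^sup>H ** (D ** D) = 0"
    by (simp add: ctranspose_mult D matrix_mul_assoc)
  then have "D\<^sup>H ** D = 0"
    using gram_zero D by metis
  then have "D = 0"
    by (rule gram_zero)
  then show ?thesis
    by (simp add: D_def)
qed

lemma psd_sqrt:
  assumes "psd Q"
  shows "psd (psd_sqrt Q)" "psd_sqrt Q ** psd_sqrt Q = Q"
proof -
  have "\<exists>!S. psd S \<and> S ** S = Q"
    using psd_sqrt_exists[OF assms] psd_sqrt_unique by metis
  from theI'[OF this] show "psd (psd_sqrt Q)" "psd_sqrt Q ** psd_sqrt Q = Q"
    by (simp_all add: psd_sqrt_def)
qed

lemma trace_sandwich:
  fixes S :: "complex^'n^'n"
  assumes "S ** S = N" shows "trace (M ** N) = trace (S ** M ** S)"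
  using trace_mul_sym[of "S ** M" S] trace_mul_sym[of M N] by (simp add: matrix_mul_assoc assms)

lemma trace_psd_psd: 
  assumes "psd M" "psd N" shows "0 \<le> Re (trace (M ** N))"
proof -
  obtain S where S: "psd S" "S ** S = N"
    using psd_sqrt_exists[OF assms(2)] .
  show ?thesis
    using psd_trace_nonneg[OF psd_congruence[OF assms(1), of S]] S
    by (simp add: trace_sandwich psd_ctranspose)
qed

lemma trace_pos_def_psd: 
  assumes "pos_def M" "psd N" "N \<noteq> 0" shows "0 < Re (trace (M ** N))"
proof (rule ccontr)
  assume neg: "\<not> 0 < Re (trace (M ** N))"
  obtain S where S: "psd S" "S ** S = N"
    using psd_sqrt_exists[OF assms(2)] .
  have "psd (S ** M ** S)"
    using psd_congruence[OF pos_def_imp_psd[OF assms(1)], of S] S by (simp add: psd_ctranspose)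
  moreover from this have "Re (trace (S ** M ** S)) = 0"
    using neg psd_trace_nonneg S trace_sandwich by (metis antisym_conv1)
  ultimately have "S\<^sup>H ** M ** S = 0"
    using psd_trace_zero S psd_ctranspose by metis
  then have "(S *v x) \<bullet> (M *v (S *v x)) = 0" for x
    by (metis inner_congruence inner_zero_right matrix_vector_mult_0)
  then have "S = 0"
    using assms(1) by (metis matrix_zero_iff pos_def_iff less_irrefl)
  then show False
    using S assms(3) by simp
qed

lemma pos_def_det:
  fixes M :: "complex^'n^'n"
  assumes "pos_def M" shows "0 < Re (det M)" "Im (det M) = 0"
proof -
  obtain U :: "complex^'n^'n" and d :: "'n \<Rightarrow> real" where U: "U\<^sup>H ** U = mat 1" "U ** U\<^sup>H = mat 1"
    "M = U ** real_diag d ** U\<^sup>H" and d: "\<forall>i. 0 < d i"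
    using pos_def_diagonalization[OF assms] .
  have "det M = of_real (prod d UNIV)"
    unfolding U(3) by (simp only: det_conj[OF U(1)] det_real_diag)
  then show "0 < Re (det M)" "Im (det M) = 0"
    using d by (simp_all add: prod_pos del: of_real_prod)
qed

lemma log_det_mult:
  assumes "pos_def M" "pos_def N" "det L = det M * det N"
  shows "log_det L = log_det M + log_det N"
proof -
  have "Re (det L) = Re (det M) * Re (det N)"
    unfolding assms(3) by (simp add: pos_def_det(2)[OF assms(1)])
  then show ?thesis
    unfolding log_det_def using pos_def_det(1)[OF assms(1)] pos_def_det(1)[OF assms(2)]
    by (simp only: ln_mult_pos)
qed

section \<open>The tangent inequality for the logarithm of the determinant\<close>

text \<open>Apply \<open>ln x \<le> x - 1\<close> to each eigenvalue; equality occurs only if all of them are 1.\<close>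

lemma log_det_le_trace:
  fixes Z :: "complex^'n^'n"
  assumes "pos_def Z"
  shows "log_det Z \<le> Re (trace Z) - CARD('n)"
    and "Z \<noteq> mat 1 \<Longrightarrow> log_det Z < Re (trace Z) - CARD('n)"
proof -
  obtain U :: "complex^'n^'n" and d :: "'n \<Rightarrow> real" where U: "U\<^sup>H ** U = mat 1" "U ** U\<^sup>H = mat 1"
    "Z = U ** real_diag d ** U\<^sup>H" and d: "\<forall>i. 0 < d i"
    using pos_def_diagonalization[OF assms] .
  have ld: "log_det Z = (\<Sum>i\<in>UNIV. ln (d i))"
    unfolding U(3) using d by (simp add: log_det_def det_conj[OF U(1)] det_real_diag ln_prod less_imp_neq[THEN not_sym] del: of_real_prod)
  have tr: "Re (trace Z) - CARD('n) = (\<Sum>i\<in>UNIV. d i - 1)"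
    unfolding U(3) by (simp add: trace_conj[OF U(1)] trace_real_diag sum_subtractf del: of_real_sum)
  show "log_det Z \<le> Re (trace Z) - CARD('n)"
    unfolding ld tr using d by (intro sum_mono) (simp add: ln_le_minus_one)
  assume "Z \<noteq> mat 1"
  obtain i where "d i \<noteq> 1"
  proof (rule ccontr)
    assume "\<not> thesis"
    then have "d = (\<lambda>_. 1)"
      using that by auto
    then have "real_diag d = mat 1"
      by (simp add: real_diag_def mat_def vec_eq_iff)
    with U \<open>Z \<noteq> mat 1\<close> show False
      by simp
  qed
  then have "ln (d i) < d i - 1"
    using d[rule_format, of i] ln_eq_minus_one[of "d i"] ln_le_minus_one[of "d i"] by fastforce
  then show "log_det Z < Re (trace Z) - CARD('n)"
    unfolding ld tr using d by (intro sum_strict_mono_ex1) (auto simp: ln_le_minus_one)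
qed

text \<open>Strict concavity of \<open>log det\<close>, as a tangent inequality. Conjugation by the square root of \<open>X\<^sup>-\<^sup>1\<close>
  reduces it to the case where \<open>X\<close> is the identity, which is \<open>log_det_le_trace\<close>.\<close>

lemma log_det_tangent:
  fixes X Y :: "complex^'n^'n"
  assumes X: "pos_def X" and Y: "pos_def Y"
  shows "log_det Y - log_det X \<le> Re (trace (matrix_inv X ** (Y - X)))"
    and "Y \<noteq> X \<Longrightarrow> log_det Y - log_det X < Re (trace (matrix_inv X ** (Y - X)))"
proof -
  note iX = matrix_inv_mult[OF pos_def_invertible[OF X]]
  obtain S where S: "psd S" "S ** S = matrix_inv X"
    using psd_sqrt_exists[OF pos_def_imp_psd[OF pos_def_inv[OF X]]] .
  have SX: "S ** (S ** X) = mat 1"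
    using S iX by (simp add: matrix_mul_assoc)
  then have SXS: "S ** X ** S = mat 1"
    using matrix_left_right_inverse by blast
  then have "invertible S"
    using invertible_right_inverse by (metis matrix_mul_assoc)
  have Z: "pos_def (S ** Y ** S)"
    using pos_def_congruence[OF Y \<open>invertible S\<close>] S psd_ctranspose by metis
  have det: "det (S ** Y ** S) * det X = det Y"
  proof -
    have "det S * det S * det X = 1"
      by (metis SX det_I det_mul mult.assoc)
    then show ?thesis
      by (simp add: det_mul ac_simps)
  qed
  then have ld: "log_det (S ** Y ** S) = log_det Y - log_det X"
    using log_det_mult[OF Z X det[symmetric]] by simp
  have tr: "Re (trace (S ** Y ** S)) - CARD('n) = Re (trace (matrix_inv X ** (Y - X)))"
    using trace_sandwich[OF S(2), of Y] iX trace_mul_sym[of Y]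
    by (simp add: mat_distribs trace_sub trace_I)
  show "log_det Y - log_det X \<le> Re (trace (matrix_inv X ** (Y - X)))"
    using log_det_le_trace(1)[OF Z] by (simp only: ld tr)
  assume "Y \<noteq> X"
  have "S ** Y ** S \<noteq> mat 1"
  proof
    assume *: "S ** Y ** S = mat 1"
    then have "matrix_inv S = Y ** S" "matrix_inv S = X ** S"
      using SXS by (auto intro!: matrix_inv_eqI simp: matrix_mul_assoc)
    then have "Y ** S ** matrix_inv S = X ** S ** matrix_inv S"
      by simp
    then have "Y ** (S ** matrix_inv S) = X ** (S ** matrix_inv S)"
      by (simp only: matrix_mul_assoc)
    with \<open>Y \<noteq> X\<close> show False
      by (simp add: matrix_inv_mult[OF \<open>invertible S\<close>])
  qed
  from log_det_le_trace(2)[OF Z this] show "log_det Y - log_det X < Re (trace (matrix_inv X ** (Y - X)))"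
    by (simp only: ld tr)
qed

section \<open>Exchanging the two Gram determinants\<close>

definition block_matrix ::
  "complex^'t^'t \<Rightarrow> complex^'r^'t \<Rightarrow> complex^'t^'r \<Rightarrow> complex^'r^'r \<Rightarrow> complex^('t+'r)^('t+'r)"
  where "block_matrix A B C D = (\<chi> i j.
    case i of Inl i' \<Rightarrow> (case j of Inl j' \<Rightarrow> A $ i' $ j' | Inr j' \<Rightarrow> B $ i' $ j')
            | Inr i' \<Rightarrow> (case j of Inl j' \<Rightarrow> C $ i' $ j' | Inr j' \<Rightarrow> D $ i' $ j'))"

lemma sum_over_sum_type:
  "(\<Sum>k\<in>UNIV. f k) = (\<Sum>k\<in>UNIV. f (Inl k)) + (\<Sum>k\<in>UNIV. f (Inr k))"
  for f :: "'t::finite + 'r::finite \<Rightarrow> 'a::comm_monoid_add"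
  unfolding UNIV_Plus_UNIV[symmetric] by (subst sum.Plus) (simp_all add: comp_def)

lemma block_matrix_mult:
  "block_matrix A B C D ** block_matrix A' B' C' D' =
    block_matrix (A ** A' + B ** C') (A ** B' + B ** D') (C ** A' + D ** C') (C ** B' + D ** D')"
  by (simp add: vec_eq_iff block_matrix_def matrix_matrix_mult_def sum_over_sum_type split: sum.split)

lemma block_matrix_mat_1: "block_matrix (mat 1) 0 0 (mat 1) = mat 1"
  by (simp add: vec_eq_iff block_matrix_def mat_def split: sum.split)

lemma det_block_unit_nonzero:
  "det (block_matrix (mat 1) B 0 (mat 1)) \<noteq> 0" "det (block_matrix (mat 1) 0 C (mat 1)) \<noteq> 0"
proof -
  have "block_matrix (mat 1) B 0 (mat 1) ** block_matrix (mat 1) (- B) 0 (mat 1) = mat 1"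
    "block_matrix (mat 1) 0 C (mat 1) ** block_matrix (mat 1) 0 (- C) (mat 1) = mat 1"
    by (simp_all add: block_matrix_mult block_matrix_mat_1)
  then show "det (block_matrix (mat 1) B 0 (mat 1)) \<noteq> 0" "det (block_matrix (mat 1) 0 C (mat 1)) \<noteq> 0"
    using invertible_det_nz invertible_right_inverse by metis+
qed

text \<open>Diagonalizing both blocks by unitary matrices reduces the claim to diagonal matrices.\<close>

lemma det_block_diag:
  fixes M :: "complex^'t^'t" and N :: "complex^'r^'r"
  assumes M: "M\<^sup>H = M" and N: "N\<^sup>H = N"
  shows "det (block_matrix M 0 0 N) = det M * det N"
proof -
  obtain U :: "complex^'t^'t" and d where U: "U\<^sup>H ** U = mat 1" "U ** U\<^sup>H = mat 1"
    "M = U ** real_diag d ** U\<^sup>H"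
    using hermitian_diagonalization[OF M] .
  obtain V :: "complex^'r^'r" and e where V: "V\<^sup>H ** V = mat 1" "V ** V\<^sup>H = mat 1"
    "N = V ** real_diag e ** V\<^sup>H"
    using hermitian_diagonalization[OF N] .
  define W where "W = block_matrix U 0 0 V"
  define W' where "W' = block_matrix (U\<^sup>H) 0 0 (V\<^sup>H)"
  define f where "f k = (case k of Inl i \<Rightarrow> d i | Inr j \<Rightarrow> e j)" for k
  have "W ** real_diag f ** W' = block_matrix M 0 0 N"
  proof -
    have "real_diag f = block_matrix (real_diag d) 0 0 (real_diag e)"
      by (simp add: vec_eq_iff block_matrix_def real_diag_def f_def split: sum.split)
    then show ?thesis
      by (simp add: W_def W'_def block_matrix_mult U(3) V(3))
  qed
  moreover have "det W * det W' = 1"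
    unfolding det_mul[symmetric] by (simp add: W_def W'_def block_matrix_mult U V block_matrix_mat_1)
  ultimately have "det (block_matrix M 0 0 N) = det (real_diag f)"
    by (metis det_mul mult.commute mult.left_commute mult.right_neutral)
  moreover have "prod f UNIV = prod d UNIV * prod e UNIV"
    unfolding UNIV_Plus_UNIV[symmetric] by (subst prod.Plus) (simp_all add: comp_def f_def)
  ultimately show ?thesis
    unfolding U(3) V(3) det_conj[OF U(1)] det_conj[OF V(1)] det_real_diag by simp
qed

text \<open>Both determinants are the determinant of the block matrix with rows \<open>(1, -B\<^sup>H)\<close> and \<open>(B, 1)\<close>, read off
  from its two block triangular factorizations. The same two triangular factors occur on both sides, so only
  their invertibility matters.\<close>

theorem det_gram_swap:
  fixes B :: "complex^'t^'r"
  shows "det (mat 1 + B\<^sup>H ** B) = det (mat 1 + B ** B\<^sup>H)"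
proof -
  let ?L = "block_matrix (mat 1) 0 B (mat 1)" and ?R = "block_matrix (mat 1) (- (B\<^sup>H)) 0 (mat 1)"
  let ?M = "block_matrix (mat 1 + B\<^sup>H ** B) 0 0 (mat 1 :: complex^'r^'r)"
  let ?N = "block_matrix (mat 1 :: complex^'t^'t) 0 0 (mat 1 + B ** B\<^sup>H)"
  have "?L ** (?N ** ?R) = (?R ** ?M) ** ?L"
    using matrix_diff_ldist[of B 0 "B\<^sup>H"] matrix_diff_rdist[of 0 "B\<^sup>H" B]
    by (simp add: block_matrix_mult)
  from arg_cong[OF this, of det]
  have "det ?L * (det ?N * det ?R) = det ?R * det ?M * det ?L"
    by (simp only: det_mul)
  then have "det ?N = det ?M"
    using det_block_unit_nonzero(1)[of "- (B\<^sup>H)"] det_block_unit_nonzero(2)[of B] by simp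
  then show ?thesis
    by (simp add: det_block_diag ctranspose_mult)
qed

section \<open>The log-determinant as a function of two scalar variables\<close>

lemma matrix_inv_scaleR:
  assumes "invertible (M :: complex^'n^'n)" "c \<noteq> 0"
  shows "matrix_inv (c *\<^sub>R M) = (1 / c) *\<^sub>R matrix_inv M"
  by (rule matrix_inv_eqI) (simp add: mat_distribs matrix_inv_mult[OF assms(1)] assms(2))

text \<open>With \<open>D = Y - X\<close>, the difference of the inverses is a sum of two congruence transforms:
  \<open>X\<^sup>-\<^sup>1 - Y\<^sup>-\<^sup>1 = Y\<^sup>-\<^sup>1 D Y\<^sup>-\<^sup>1 + Y\<^sup>-\<^sup>1 (D X\<^sup>-\<^sup>1 D) Y\<^sup>-\<^sup>1\<close>.\<close>

lemma matrix_inv_antitone: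
  fixes X Y :: "complex^'n^'n"
  assumes X: "pos_def X" and D: "psd (Y - X)"
  shows "psd (matrix_inv X - matrix_inv Y)"
    and "pos_def (Y - X) \<Longrightarrow> pos_def (matrix_inv X - matrix_inv Y)"
proof -
  define D where "D = Y - X"
  define S T where "S = matrix_inv X" and "T = matrix_inv Y"
  have Y: "pos_def Y"
    using pos_def_add[OF X D] by simp
  have S: "X ** S = mat 1" "S ** X = mat 1" and T: "Y ** T = mat 1" "T ** Y = mat 1"
    unfolding S_def T_def
    using matrix_inv_mult[OF pos_def_invertible[OF X]] matrix_inv_mult[OF pos_def_invertible[OF Y]] by auto
  have TH: "T\<^sup>H = T"
    unfolding T_def by (rule pos_def_ctranspose[OF pos_def_inv[OF Y]])
  have DH: "D\<^sup>H = D"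
    unfolding D_def by (rule psd_ctranspose[OF D])
  have "T ** D ** T + T ** (D ** S ** D) ** T
      = T ** (D + D ** S ** D) ** T"
    by (simp add: mat_distribs)
  also have "D + D ** S ** D = D ** (S ** X) + D ** S ** D"
    by (simp add: S)
  also have "\<dots> = D ** S ** Y"
    by (simp add: D_def mat_distribs)
  also have "T ** (D ** S ** Y) ** T = T ** D ** S ** (Y ** T)"
    by (simp only: matrix_mul_assoc)
  also have "\<dots> = (T ** Y) ** S - T ** (X ** S)"
    by (simp add: D_def T mat_distribs)
  finally have eq: "S - T = T\<^sup>H ** D ** T + T\<^sup>H ** (D\<^sup>H ** S ** D) ** T"
    by (simp add: TH DH S T)
  have 2: "psd (T\<^sup>H ** (D\<^sup>H ** S ** D) ** T)"
    unfolding S_def by (intro psd_congruence pos_def_imp_psd pos_def_inv X)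
  show "psd (matrix_inv X - matrix_inv Y)"
    using psd_add[OF psd_congruence[of D T] 2] D eq by (simp add: D_def S_def T_def)
  show "pos_def (matrix_inv X - matrix_inv Y)" if "pos_def (Y - X)"
  proof -
    have "invertible T"
      using T invertible_right_inverse by blast
    then show ?thesis
      using pos_def_add[OF pos_def_congruence[of D T] 2] that eq by (simp add: D_def S_def T_def)
  qed
qed

text \<open>The Schur complement of the lower right block in the block matrix with rows \<open>(1 + \<kappa> P, -B\<^sup>H)\<close> and
  \<open>(B, 1 + \<kappa>t N)\<close>. The other Schur complement is \<open>schur N P (B\<^sup>H) \<kappa>t \<kappa>\<close>, so each statement about one
  of them yields its mirror image by exchanging the two sides.\<close>

definition schur ::
  "complex^'t^'t \<Rightarrow> complex^'r^'r \<Rightarrow> complex^'t^'r \<Rightarrow> real \<Rightarrow> real \<Rightarrow> complex^'t^'t"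
  where "schur P N B \<kappa> \<kappa>t = mat 1 + \<kappa> *\<^sub>R P + B\<^sup>H ** matrix_inv (mat 1 + \<kappa>t *\<^sub>R N) ** B"

text \<open>The logarithm of the determinant of the block matrix described at \<open>schur\<close>.\<close>

definition energy ::
  "complex^'t^'t \<Rightarrow> complex^'r^'r \<Rightarrow> complex^'t^'r \<Rightarrow> real \<Rightarrow> real \<Rightarrow> real"
  where "energy P N B \<kappa> \<kappa>t = log_det (schur P N B \<kappa> \<kappa>t) + log_det (mat 1 + \<kappa>t *\<^sub>R N)"

text \<open>The derivative of \<open>energy P N B\<close> with respect to \<open>\<kappa>\<close>; the tangent inequality
  \<open>energy_tangent\<close> expresses this without a limit.\<close>

definition slope ::
  "complex^'t^'t \<Rightarrow> complex^'r^'r \<Rightarrow> complex^'t^'r \<Rightarrow> real \<Rightarrow> real \<Rightarrow> real"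
  where "slope P N B \<kappa> \<kappa>t = Re (trace (matrix_inv (schur P N B \<kappa> \<kappa>t) ** P))"

lemma pos_def_one_plus: "psd N \<Longrightarrow> 0 \<le> k \<Longrightarrow> pos_def (mat 1 + k *\<^sub>R N)"
  by (intro pos_def_add pos_def_mat_1 psd_scaleR)

lemma schur_pos_def:
  assumes "psd P" "psd N" "0 \<le> \<kappa>" "0 \<le> \<kappa>t"
  shows "pos_def (schur P N B \<kappa> \<kappa>t)"
  unfolding schur_def using assms
  by (intro pos_def_add[OF pos_def_one_plus] psd_congruence[OF pos_def_imp_psd[OF pos_def_inv[OF pos_def_one_plus]]])

text \<open>The two Schur complement formulas for the determinant of one block matrix. Pulling out the square roots of
  \<open>X\<^sup>-\<^sup>1\<close> and \<open>Z\<^sup>-\<^sup>1\<close> reduces them to \<open>det_gram_swap\<close>.\<close>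

lemma det_schur_swap:
  fixes X :: "complex^'t^'t" and Z :: "complex^'r^'r"
  assumes X: "pos_def X" and Z: "pos_def Z"
  shows "det (X + B\<^sup>H ** matrix_inv Z ** B) * det Z = det (Z + B ** matrix_inv X ** B\<^sup>H) * det X"
proof -
  have factor: "det (Y + E\<^sup>H ** matrix_inv W ** E) = det (mat 1 + (T ** E ** S)\<^sup>H ** (T ** E ** S)) * det Y"
    if Y: "pos_def Y" and S: "psd S" "S ** S = matrix_inv Y" and T: "psd T" "T ** T = matrix_inv W"
    for Y S :: "complex^'n^'n" and W T :: "complex^'m^'m" and E
  proof -
    have "S ** (S ** Y) = mat 1"
      using matrix_inv_mult(2)[OF pos_def_invertible[OF Y]] S by (simp add: matrix_mul_assoc)
    then have SYS: "S ** Y ** S = mat 1" and det: "det S * det S * det Y = 1"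
      by (metis matrix_left_right_inverse matrix_mul_assoc, metis det_I det_mul mult.assoc)
    have "mat 1 + (T ** E ** S)\<^sup>H ** (T ** E ** S) = S ** (Y + E\<^sup>H ** (T ** T) ** E) ** S"
      using S(1) T(1) by (simp add: SYS mat_distribs ctranspose_mult psd_ctranspose)
    then show ?thesis
      using det by (simp add: T det_mul ac_simps)
  qed
  obtain S where S: "psd S" "S ** S = matrix_inv X"
    using psd_sqrt_exists[OF pos_def_imp_psd[OF pos_def_inv[OF X]]] .
  obtain T where T: "psd T" "T ** T = matrix_inv Z"
    using psd_sqrt_exists[OF pos_def_imp_psd[OF pos_def_inv[OF Z]]] .
  have "(T ** B ** S)\<^sup>H = S ** B\<^sup>H ** T"
    using S T by (simp add: ctranspose_mult psd_ctranspose matrix_mul_assoc)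
  then have "det (mat 1 + (T ** B ** S)\<^sup>H ** (T ** B ** S))
      = det (mat 1 + (S ** B\<^sup>H ** T)\<^sup>H ** (S ** B\<^sup>H ** T))"
    by (metis det_gram_swap ctranspose_simps(4))
  then show ?thesis
    using factor[OF X S T, of B] factor[OF Z T S, of "B\<^sup>H"] by simp
qed

text \<open>The energy is symmetric in the two sides. In the form on the right, \<open>\<kappa>t\<close> enters only through the log-determinant
  of a matrix that is affine in \<open>\<kappa>t\<close>, whence the concavity in \<open>\<kappa>t\<close>.\<close>

lemma energy_swap:
  assumes "psd P" "psd N" "0 \<le> \<kappa>" "0 \<le> \<kappa>t"
  shows "energy P N B \<kappa> \<kappa>t = energy N P (B\<^sup>H) \<kappa>t \<kappa>"
proof -
  have pd: "pos_def (mat 1 + \<kappa> *\<^sub>R P)" "pos_def (mat 1 + \<kappa>t *\<^sub>R N)"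
    using assms by (auto intro: pos_def_one_plus)
  have d: "det (schur P N B \<kappa> \<kappa>t) * det (mat 1 + \<kappa>t *\<^sub>R N)
      = det (schur N P (B\<^sup>H) \<kappa>t \<kappa>) * det (mat 1 + \<kappa> *\<^sub>R P)"
    unfolding schur_def using det_schur_swap[OF pd] by simp
  have "log_det A + log_det A' = log_det D + log_det D'"
    if "pos_def A" "pos_def A'" "pos_def D" "pos_def D'" "det A * det A' = det D * det D'"
    for A :: "complex^'n^'n" and A' :: "complex^'m^'m" and D :: "complex^'k^'k" and D' :: "complex^'l^'l"
  proof -
    have "Re (det A) * Re (det A') = Re (det D) * Re (det D')"
      using arg_cong[OF that(5), of Re] that(1-4)[THEN pos_def_det(2)] by simp
    then show ?thesis
      unfolding log_det_def using that by (metis ln_mult_pos pos_def_det(1))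
  qed
  from this[OF schur_pos_def[OF assms] pd(2) schur_pos_def[OF assms(2,1,4,3)] pd(1) d] show ?thesis
    by (simp only: energy_def)
qed

lemma energy_tangent:
  assumes P: "psd P" and N: "psd N" and nonneg: "0 \<le> \<kappa>" "0 \<le> \<kappa>'" "0 \<le> \<kappa>t"
  shows "energy P N B \<kappa>' \<kappa>t - energy P N B \<kappa> \<kappa>t \<le> (\<kappa>' - \<kappa>) * slope P N B \<kappa> \<kappa>t"
    and "P \<noteq> 0 \<Longrightarrow> \<kappa>' \<noteq> \<kappa> \<Longrightarrow>
      energy P N B \<kappa>' \<kappa>t - energy P N B \<kappa> \<kappa>t < (\<kappa>' - \<kappa>) * slope P N B \<kappa> \<kappa>t"
proof -
  have D: "schur P N B \<kappa>' \<kappa>t - schur P N B \<kappa> \<kappa>t = (\<kappa>' - \<kappa>) *\<^sub>R P"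
    by (simp add: schur_def algebra_simps)
  then have r: "(\<kappa>' - \<kappa>) * slope P N B \<kappa> \<kappa>t
      = Re (trace (matrix_inv (schur P N B \<kappa> \<kappa>t) ** (schur P N B \<kappa>' \<kappa>t - schur P N B \<kappa> \<kappa>t)))"
    by (simp add: slope_def matrix_scaleR_right trace_scaleR)
  have l: "energy P N B \<kappa>' \<kappa>t - energy P N B \<kappa> \<kappa>t
      = log_det (schur P N B \<kappa>' \<kappa>t) - log_det (schur P N B \<kappa> \<kappa>t)"
    by (simp add: energy_def)
  have pd: "pos_def (schur P N B \<kappa> \<kappa>t)" "pos_def (schur P N B \<kappa>' \<kappa>t)"
    using schur_pos_def P N nonneg by blast+
  show "energy P N B \<kappa>' \<kappa>t - energy P N B \<kappa> \<kappa>t \<le> (\<kappa>' - \<kappa>) * slope P N B \<kappa> \<kappa>t"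
    unfolding l r by (rule log_det_tangent(1)[OF pd])
  assume "P \<noteq> 0" "\<kappa>' \<noteq> \<kappa>"
  then have "schur P N B \<kappa>' \<kappa>t \<noteq> schur P N B \<kappa> \<kappa>t"
    using D by auto
  then show "energy P N B \<kappa>' \<kappa>t - energy P N B \<kappa> \<kappa>t < (\<kappa>' - \<kappa>) * slope P N B \<kappa> \<kappa>t"
    unfolding l r by (rule log_det_tangent(2)[OF pd])
qed

lemma slope_nonneg:
  "psd P \<Longrightarrow> psd N \<Longrightarrow> 0 \<le> \<kappa> \<Longrightarrow> 0 \<le> \<kappa>t \<Longrightarrow> 0 \<le> slope P N B \<kappa> \<kappa>t"
  unfolding slope_def by (intro trace_psd_psd pos_def_imp_psd[OF pos_def_inv[OF schur_pos_def]])

lemma slope_pos: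
  "psd P \<Longrightarrow> P \<noteq> 0 \<Longrightarrow> psd N \<Longrightarrow> 0 \<le> \<kappa> \<Longrightarrow> 0 \<le> \<kappa>t \<Longrightarrow> 0 < slope P N B \<kappa> \<kappa>t"
  unfolding slope_def by (intro trace_pos_def_psd pos_def_inv[OF schur_pos_def])

text \<open>A larger \<open>\<kappa>t\<close> makes \<open>(1 + \<kappa>t N)\<^sup>-\<^sup>1\<close> smaller, hence the Schur complement smaller, hence its inverse
  larger.\<close>

lemma slope_mono_coupling:
  assumes P: "psd P" and N: "psd N" and nonneg: "0 \<le> \<kappa>" "0 \<le> \<kappa>t" "\<kappa>t \<le> \<kappa>t'"
  shows "slope P N B \<kappa> \<kappa>t \<le> slope P N B \<kappa> \<kappa>t'"
proof -
  have "(mat 1 + \<kappa>t' *\<^sub>R N) - (mat 1 + \<kappa>t *\<^sub>R N) = (\<kappa>t' - \<kappa>t) *\<^sub>R N"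
    by (simp add: algebra_simps)
  then have "psd ((mat 1 + \<kappa>t' *\<^sub>R N) - (mat 1 + \<kappa>t *\<^sub>R N))"
    using N nonneg by (simp only:) (intro psd_scaleR; simp)
  then have "psd (matrix_inv (mat 1 + \<kappa>t *\<^sub>R N) - matrix_inv (mat 1 + \<kappa>t' *\<^sub>R N))"
    using N nonneg by (intro matrix_inv_antitone(1) pos_def_one_plus)
  from psd_congruence[OF this, of B] have "psd (schur P N B \<kappa> \<kappa>t - schur P N B \<kappa> \<kappa>t')"
    by (simp add: schur_def mat_distribs)
  then have "psd (matrix_inv (schur P N B \<kappa> \<kappa>t') - matrix_inv (schur P N B \<kappa> \<kappa>t))"
    using P N nonneg by (intro matrix_inv_antitone(1) schur_pos_def) auto
  from trace_psd_psd[OF this P] show ?thesis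
    by (simp add: slope_def matrix_diff_rdist trace_sub)
qed

text \<open>The matrix \<open>\<kappa> X\<^sup>-\<^sup>1\<close>, with \<open>X\<close> the Schur complement, is the inverse of
  \<open>1 / \<kappa> + P + B\<^sup>H (\<kappa> + p N)\<^sup>-\<^sup>1 B\<close> with \<open>p = \<kappa> \<kappa>t\<close>. For constant \<open>p\<close> this matrix decreases strictly
  in \<open>\<kappa>\<close>, so its inverse increases strictly. This is why the energy is convex along a hyperbola.\<close>

lemma slope_mono_hyperbola:
  assumes P: "psd P" "P \<noteq> 0" and N: "psd N" 
    and pos: "0 < \<kappa>" "\<kappa> < \<kappa>'" "0 \<le> \<kappa>t" "0 \<le> \<kappa>t'" and eq: "\<kappa> * \<kappa>t = \<kappa>' * \<kappa>t'"
  shows "\<kappa> * slope P N B \<kappa> \<kappa>t < \<kappa>' * slope P N B \<kappa>' \<kappa>t'"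
proof -
  define p where "p = \<kappa> * \<kappa>t"
  \<comment> \<open>\<open>Y k\<close> is the Schur complement divided by \<open>k\<close>.\<close>
  define F where "F k = k *\<^sub>R mat 1 + p *\<^sub>R N" for k
  define Y where "Y k = (1 / k) *\<^sub>R mat 1 + P + B\<^sup>H ** matrix_inv (F k) ** B" for k
  have "0 \<le> p"
    using pos by (simp add: p_def)
  then have F: "pos_def (F k)" if "0 < k" for k
    unfolding F_def using that N by (intro pos_def_add pos_def_scaleR pos_def_mat_1 psd_scaleR)
  have resc: "(1 / k) *\<^sub>R schur P N B k kt = Y k" if "0 < k" "k * kt = p" "0 \<le> kt" for k kt
  proof -
    have "F k = k *\<^sub>R (mat 1 + kt *\<^sub>R N)"
      by (simp add: F_def that(2)[symmetric] algebra_simps)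
    then have "matrix_inv (F k) = (1 / k) *\<^sub>R matrix_inv (mat 1 + kt *\<^sub>R N)"
      using that N by (simp add: matrix_inv_scaleR pos_def_invertible pos_def_one_plus)
    then show ?thesis
      using that by (simp add: Y_def schur_def mat_distribs scaleR_add_right)
  qed
  have slope: "k * slope P N B k kt = Re (trace (matrix_inv (Y k) ** P))"
    if "0 < k" "k * kt = p" "0 \<le> kt" for k kt
  proof -
    have "matrix_inv (Y k) = k *\<^sub>R matrix_inv (schur P N B k kt)"
      using that P N
      by (simp add: resc[symmetric] matrix_inv_scaleR[OF pos_def_invertible[OF schur_pos_def]])
    then show ?thesis
      by (simp add: slope_def mat_distribs trace_scaleR)
  qed
  have Ypd: "pos_def (Y k)" if "0 < k" for k
    unfolding Y_def using that P F
    by (intro pos_def_add[OF pos_def_add] pos_def_scaleR[OF pos_def_mat_1]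
        psd_congruence[OF pos_def_imp_psd[OF pos_def_inv]]) auto
  have "F \<kappa>' - F \<kappa> = (\<kappa>' - \<kappa>) *\<^sub>R mat 1"
    by (simp add: F_def algebra_simps)
  then have "psd (F \<kappa>' - F \<kappa>)"
    using pos by (simp add: psd_scaleR pos_def_imp_psd pos_def_mat_1)
  then have 1: "psd (B\<^sup>H ** (matrix_inv (F \<kappa>) - matrix_inv (F \<kappa>')) ** B)"
    using F pos by (intro psd_congruence matrix_inv_antitone(1)) auto
  have "Y \<kappa> - Y \<kappa>' = (1 / \<kappa> - 1 / \<kappa>') *\<^sub>R mat 1 + B\<^sup>H ** (matrix_inv (F \<kappa>) - matrix_inv (F \<kappa>')) ** B"
    by (simp add: Y_def mat_distribs scaleR_diff_left)
  moreover have "0 < 1 / \<kappa> - 1 / \<kappa>'"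
    using pos by (simp add: field_simps)
  ultimately have "pos_def (Y \<kappa> - Y \<kappa>')"
    using 1 by (simp only:) (intro pos_def_add pos_def_scaleR pos_def_mat_1)
  then have "pos_def (matrix_inv (Y \<kappa>') - matrix_inv (Y \<kappa>))"
    using Ypd pos by (intro matrix_inv_antitone(2) pos_def_imp_psd) auto
  from trace_pos_def_psd[OF this P] have "0 < Re (trace (matrix_inv (Y \<kappa>') ** P)) - Re (trace (matrix_inv (Y \<kappa>) ** P))"
    by (simp add: matrix_diff_rdist trace_sub)
  then show ?thesis
    using slope[of \<kappa> \<kappa>t] slope[of \<kappa>' \<kappa>t'] pos eq by (simp add: p_def)
qed

section \<open>Stationary points and the hyperbolas through them\<close>

text \<open>A function whose decrease over a step is at most quadratic in the step length does not decrease: over \<open>n\<close>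
  equal steps the total loss is of order \<open>1 / n\<close>. This replaces the statement that a function with
  nonnegative derivative is monotone.\<close>

lemma mono_of_quadratic_defect:
  fixes h :: "real \<Rightarrow> real"
  assumes defect: "\<And>x y. a \<le> x \<Longrightarrow> x \<le> y \<Longrightarrow> h x - c * (y - x)\<^sup>2 \<le> h y" and "a \<le> b"
  shows "h a \<le> h b"
proof (rule ccontr)
  assume "\<not> h a \<le> h b"
  then have gap: "0 < h a - h b" by simp
  then obtain n :: nat where n: "c * (b - a)\<^sup>2 < real n * (h a - h b)"
    using reals_Archimedean3 by blast
  define e where "e = (b - a) / real n"
  have "0 \<le> e"
    using \<open>a \<le> b\<close> by (simp add: e_def)
  have "h a - real k * (c * e\<^sup>2) \<le> h (a + real k * e)" for k
  proof (induction k)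
    case (Suc k)
    have "h (a + real k * e) - c * (a + real (Suc k) * e - (a + real k * e))\<^sup>2 \<le> h (a + real (Suc k) * e)"
      using \<open>0 \<le> e\<close> by (intro defect) (simp_all add: algebra_simps)
    with Suc show ?case
      by (simp add: algebra_simps)
  qed simp
  from this[of n] have le: "h a - real n * (c * e\<^sup>2) \<le> h (a + real n * e)" .
  show False
  proof (cases "n = 0")
    case True
    with n gap defect[of a b] \<open>a \<le> b\<close> show ?thesis
      by simp
  next
    case False
    then have "h a - c * (b - a)\<^sup>2 / real n \<le> h b"
      using le by (simp add: e_def power2_eq_square)
    then have "real n * (h a - h b) \<le> c * (b - a)\<^sup>2"
      using False by (simp add: field_simps)
    with n show ?thesis by simp
  qed
qed

text \<open>One half of the hyperbola, parametrized by \<open>\<theta>\<close>. The assumption \<open>bal\<close> says that the derivative along the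
  hyperbola vanishes at \<open>\<theta> = 1\<close>. By \<open>slope_mono_hyperbola\<close> the two contributions to the derivative move apart
  from their common value \<open>g\<close> in the favourable direction as \<open>\<theta>\<close> grows. A step from \<open>x\<close> to \<open>y\<close> is split
  into a change of \<open>\<kappa>\<close> followed by a change of \<open>\<kappa>t\<close>; the tangent inequalities bound their contributions from
  below by \<open>(y - x) g / y\<close> and \<open>-(y - x) g / x\<close>, which cancel up to second order.\<close>

lemma energy_hyperbola_expand:
  assumes P: "psd P" "P \<noteq> 0" and N: "psd N" "N \<noteq> 0" and pos: "0 < \<kappa>" "0 < \<kappa>t"
    and bal: "\<kappa> * slope P N B \<kappa> \<kappa>t = \<kappa>t * slope N P (B\<^sup>H) \<kappa>t \<kappa>"
    and "1 \<le> \<theta>"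
  shows "energy P N B \<kappa> \<kappa>t \<le> energy P N B (\<theta> * \<kappa>) (\<kappa>t / \<theta>)"
proof -
  define g where "g = \<kappa> * slope P N B \<kappa> \<kappa>t"
  have "0 \<le> g"
    using slope_nonneg[of P N \<kappa> \<kappa>t B] P N pos by (simp add: g_def)
  have defect: "energy P N B (x * \<kappa>) (\<kappa>t / x) - g * (y - x)\<^sup>2 \<le> energy P N B (y * \<kappa>) (\<kappa>t / y)"
    if "1 \<le> x" "x \<le> y" for x y
  proof -
    have "0 < x" "0 < y" using that by auto
    have nn: "0 \<le> x * \<kappa>" "0 \<le> y * \<kappa>" "0 \<le> \<kappa>t / x" "0 \<le> \<kappa>t / y"
      using pos \<open>0 < x\<close> \<open>0 < y\<close> by auto
    have 1: "g \<le> y * \<kappa> * slope P N B (y * \<kappa>) (\<kappa>t / y)"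
    proof (cases "y = 1")
      case False
      with that have "\<kappa> < y * \<kappa>" "\<kappa> * \<kappa>t = y * \<kappa> * (\<kappa>t / y)" using pos by auto
      with slope_mono_hyperbola[OF P N(1), of \<kappa> "y * \<kappa>" \<kappa>t "\<kappa>t / y"] show ?thesis
        using pos nn by (simp add: g_def less_imp_le)
    qed (simp add: g_def)
    have 2: "\<kappa>t / y * slope N P (B\<^sup>H) (\<kappa>t / y) (y * \<kappa>) \<le> g"
    proof (cases "y = 1")
      case False
      with that have "\<kappa>t / y < \<kappa>t" "\<kappa>t / y * (y * \<kappa>) = \<kappa>t * \<kappa>" "0 < \<kappa>t / y"
        using pos by (auto simp: divide_less_eq)
      with slope_mono_hyperbola[OF N P(1), of "\<kappa>t / y" \<kappa>t "y * \<kappa>" \<kappa> "B\<^sup>H"] show ?thesis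
        using pos nn bal by (simp add: g_def less_imp_le)
    qed (simp add: g_def bal)
    have "slope P N B (y * \<kappa>) (\<kappa>t / y) \<le> slope P N B (y * \<kappa>) (\<kappa>t / x)"
      using P N nn that pos by (intro slope_mono_coupling divide_left_mono) auto
    then have "g \<le> y * \<kappa> * slope P N B (y * \<kappa>) (\<kappa>t / x)"
      using 1 nn by (meson mult_left_mono order_trans)
    then have "(y - x) / y * g \<le> (y - x) / y * (y * \<kappa> * slope P N B (y * \<kappa>) (\<kappa>t / x))"
      using that by (intro mult_left_mono) auto
    also have "\<dots> = - ((x * \<kappa> - y * \<kappa>) * slope P N B (y * \<kappa>) (\<kappa>t / x))"
      using \<open>0 < y\<close> by (simp add: field_simps)
    also have "\<dots> \<le> energy P N B (y * \<kappa>) (\<kappa>t / x) - energy P N B (x * \<kappa>) (\<kappa>t / x)"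
      using energy_tangent(1)[OF P(1) N(1) nn(2,1,3), of B] by linarith
    finally have A: "(y - x) / y * g \<le> energy P N B (y * \<kappa>) (\<kappa>t / x) - energy P N B (x * \<kappa>) (\<kappa>t / x)" .
    have "- ((y - x) / x * g) \<le> - ((y - x) / x * (\<kappa>t / y * slope N P (B\<^sup>H) (\<kappa>t / y) (y * \<kappa>)))"
      unfolding neg_le_iff_le using 2 that by (intro mult_left_mono) auto
    also have "\<dots> = - ((\<kappa>t / x - \<kappa>t / y) * slope N P (B\<^sup>H) (\<kappa>t / y) (y * \<kappa>))"
      using \<open>0 < x\<close> \<open>0 < y\<close> by (simp add: field_simps)
    also have "\<dots> \<le> energy N P (B\<^sup>H) (\<kappa>t / y) (y * \<kappa>) - energy N P (B\<^sup>H) (\<kappa>t / x) (y * \<kappa>)"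
      using energy_tangent(1)[OF N(1) P(1) nn(4,3,2), of "B\<^sup>H"] by linarith
    also have "\<dots> = energy P N B (y * \<kappa>) (\<kappa>t / y) - energy P N B (y * \<kappa>) (\<kappa>t / x)"
      using energy_swap[OF P(1) N(1)] nn by simp
    finally have Bd: "- ((y - x) / x * g) \<le> energy P N B (y * \<kappa>) (\<kappa>t / y) - energy P N B (y * \<kappa>) (\<kappa>t / x)" .
    have "(y - x) / x * g - (y - x) / y * g = g * (y - x)\<^sup>2 / (x * y)"
      using \<open>0 < x\<close> \<open>0 < y\<close> by (simp add: field_simps power2_eq_square)
    also have "\<dots> \<le> g * (y - x)\<^sup>2 / 1"
    proof (rule divide_left_mono)
      show "1 \<le> x * y"
        using that mult_mono[of 1 x 1 y] by simp
    qed (use \<open>0 \<le> g\<close> \<open>0 < x\<close> \<open>0 < y\<close> in auto)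
    finally show ?thesis
      using A Bd by linarith
  qed
  from mono_of_quadratic_defect[of 1 "\<lambda>x. energy P N B (x * \<kappa>) (\<kappa>t / x)" g \<theta>] defect \<open>1 \<le> \<theta>\<close>
  show ?thesis
    by simp
qed

text \<open>A critical point minimizes the energy on its hyperbola. The half with \<open>\<kappa>' < \<kappa>\<close> follows from the other one by
  exchanging the two sides.\<close>

lemma energy_hyperbola:
  assumes P: "psd P" "P \<noteq> 0" and N: "psd N" "N \<noteq> 0" and pos: "0 < \<kappa>" "0 < \<kappa>t"
    and bal: "\<kappa> * slope P N B \<kappa> \<kappa>t = \<kappa>t * slope N P (B\<^sup>H) \<kappa>t \<kappa>"
    and \<kappa>': "0 < \<kappa>'"
  shows "energy P N B \<kappa> \<kappa>t \<le> energy P N B \<kappa>' (\<kappa> * \<kappa>t / \<kappa>')"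
proof (cases "\<kappa> \<le> \<kappa>'")
  case True
  have "\<kappa>t / (\<kappa>' / \<kappa>) = \<kappa> * \<kappa>t / \<kappa>'"
    by (simp add: field_simps)
  with True energy_hyperbola_expand[OF P N pos bal, of "\<kappa>' / \<kappa>"] pos \<kappa>' show ?thesis
    by (simp add: mult.commute)
next
  case False
  have "energy N P (B\<^sup>H) \<kappa>t \<kappa> \<le> energy N P (B\<^sup>H) (\<kappa> / \<kappa>' * \<kappa>t) (\<kappa> / (\<kappa> / \<kappa>'))"
    using False \<kappa>' bal by (intro energy_hyperbola_expand P N pos) simp_all
  moreover have "\<kappa> / (\<kappa> / \<kappa>') = \<kappa>'" "\<kappa> / \<kappa>' * \<kappa>t = \<kappa> * \<kappa>t / \<kappa>'"
    using pos \<kappa>' by (simp_all add: field_simps)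
  ultimately show ?thesis
    using energy_swap[OF P(1) N(1), of \<kappa> \<kappa>t B]
      energy_swap[OF P(1) N(1), of \<kappa>' "\<kappa> * \<kappa>t / \<kappa>'" B] pos \<kappa>' by simp
qed

text \<open>The critical point equations of \<open>energy P N B \<kappa> \<kappa>t - \<tau> \<kappa> \<kappa>t\<close>.\<close>

definition stationary ::
  "complex^'t^'t \<Rightarrow> complex^'r^'r \<Rightarrow> complex^'t^'r \<Rightarrow> real \<Rightarrow> real \<Rightarrow> real \<Rightarrow> bool"
  where "stationary P N B \<tau> \<kappa> \<kappa>t \<longleftrightarrow>
    slope P N B \<kappa> \<kappa>t = \<tau> * \<kappa>t \<and> slope N P (B\<^sup>H) \<kappa>t \<kappa> = \<tau> * \<kappa>"

text \<open>The energy is concave in \<open>\<kappa>t\<close> alone, so its graph lies below the tangent at the critical point.\<close>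

lemma stationary_max:
  assumes P: "psd P" and N: "psd N" and nonneg: "0 \<le> \<kappa>" "0 \<le> \<kappa>t" "0 \<le> \<kappa>t'"
    and stat: "stationary P N B \<tau> \<kappa> \<kappa>t"
  shows "energy P N B \<kappa> \<kappa>t' - \<tau> * \<kappa> * \<kappa>t' \<le> energy P N B \<kappa> \<kappa>t - \<tau> * \<kappa> * \<kappa>t"
    and "N \<noteq> 0 \<Longrightarrow> \<kappa>t' \<noteq> \<kappa>t \<Longrightarrow>
      energy P N B \<kappa> \<kappa>t' - \<tau> * \<kappa> * \<kappa>t' < energy P N B \<kappa> \<kappa>t - \<tau> * \<kappa> * \<kappa>t"
proof -
  have s: "(\<kappa>t' - \<kappa>t) * slope N P (B\<^sup>H) \<kappa>t \<kappa> = \<tau> * \<kappa> * \<kappa>t' - \<tau> * \<kappa> * \<kappa>t"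
    using stat by (simp add: stationary_def algebra_simps)
  have sw: "energy P N B \<kappa> k = energy N P (B\<^sup>H) k \<kappa>" if "0 \<le> k" for k
    using P N nonneg that by (intro energy_swap) auto
  show "energy P N B \<kappa> \<kappa>t' - \<tau> * \<kappa> * \<kappa>t' \<le> energy P N B \<kappa> \<kappa>t - \<tau> * \<kappa> * \<kappa>t"
    using energy_tangent(1)[OF N P nonneg(2,3,1), of "B\<^sup>H"] unfolding s by (simp add: sw nonneg)
  assume "N \<noteq> 0" "\<kappa>t' \<noteq> \<kappa>t"
  from energy_tangent(2)[OF N P nonneg(2,3,1) this, of "B\<^sup>H"]
  show "energy P N B \<kappa> \<kappa>t' - \<tau> * \<kappa> * \<kappa>t' < energy P N B \<kappa> \<kappa>t - \<tau> * \<kappa> * \<kappa>t"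
    unfolding s by (simp add: sw nonneg)
qed

lemma stationary_balanced:
  "stationary P N B \<tau> \<kappa> \<kappa>t \<Longrightarrow> \<kappa> * slope P N B \<kappa> \<kappa>t = \<kappa>t * slope N P (B\<^sup>H) \<kappa>t \<kappa>"
  by (simp add: stationary_def)

text \<open>Let \<open>V = energy - \<tau> \<kappa> \<kappa>t\<close>. If two critical points lie on different hyperbolas, slide the second one along
  its hyperbola to the abscissa of the first: \<open>V\<close> does not decrease, and it is then strictly below the value at the
  first point. By symmetry each value of \<open>V\<close> would be below the other. On a common hyperbola the strictly
  monotone quantity of \<open>slope_mono_hyperbola\<close> takes the same value \<open>\<tau> \<kappa> \<kappa>t\<close> at both points.\<close>

lemma stationary_unique:
  assumes P: "psd P" "P \<noteq> 0" and N: "psd N" "N \<noteq> 0" 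
    and pos1: "0 < \<kappa>1" "0 < \<kappa>t1" and pos2: "0 < \<kappa>2" "0 < \<kappa>t2"
    and s1: "stationary P N B \<tau> \<kappa>1 \<kappa>t1" and s2: "stationary P N B \<tau> \<kappa>2 \<kappa>t2"
  shows "\<kappa>1 = \<kappa>2 \<and> \<kappa>t1 = \<kappa>t2"
proof -
  define V where "V k kt = energy P N B k kt - \<tau> * k * kt" for k kt
  have less: "V k2 kt2 < V k1 kt1"
    if "0 < k1" "0 < kt1" "0 < k2" "0 < kt2" "stationary P N B \<tau> k1 kt1" "stationary P N B \<tau> k2 kt2"
      "k1 * kt1 \<noteq> k2 * kt2" for k1 kt1 k2 kt2
  proof -
    have "V k2 kt2 \<le> V k1 (k2 * kt2 / k1)"
      unfolding V_def using energy_hyperbola[OF P N that(3,4) stationary_balanced[OF that(6)] that(1)] that(1)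
      by simp
    also have "\<dots> < V k1 kt1"
      unfolding V_def using that P N by (intro stationary_max(2)) (auto simp: field_simps)
    finally show ?thesis .
  qed
  have eq: "\<kappa>1 * \<kappa>t1 = \<kappa>2 * \<kappa>t2"
    using less[OF pos1 pos2 s1 s2] less[OF pos2 pos1 s2 s1] by force
  have sl: "\<kappa>1 * slope P N B \<kappa>1 \<kappa>t1 = \<kappa>2 * slope P N B \<kappa>2 \<kappa>t2"
    using s1 s2 eq by (simp add: stationary_def)
  have "\<kappa>1 = \<kappa>2"
  proof (rule linorder_cases[of \<kappa>1 \<kappa>2])
    assume "\<kappa>1 < \<kappa>2"
    from slope_mono_hyperbola[OF P N(1) pos1(1) this, of \<kappa>t1 \<kappa>t2 B] sl eq pos1 pos2 show ?thesis by simp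
  next
    assume "\<kappa>2 < \<kappa>1"
    from slope_mono_hyperbola[OF P N(1) pos2(1) this, of \<kappa>t2 \<kappa>t1 B] sl eq pos1 pos2 show ?thesis by simp
  qed
  then show ?thesis
    using eq pos1 by simp
qed

lemma continuous_on_det:
  fixes F :: "'a::topological_space \<Rightarrow> complex^'n^'n"
  assumes "continuous_on S F"
  shows "continuous_on S (\<lambda>x. det (F x))"
  unfolding det_def using assms by (intro continuous_intros)

lemma continuous_on_matrix_mult:
  fixes F :: "'a::topological_space \<Rightarrow> complex^'n^'m" and G :: "'a \<Rightarrow> complex^'k^'n"
  assumes "continuous_on S F" "continuous_on S G"
  shows "continuous_on S (\<lambda>x. F x ** G x)"
  unfolding matrix_matrix_mult_def using assms by (intro continuous_intros)

text \<open>Cramer's rule, which makes the inverse visibly continuous in the entries.\<close>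

lemma matrix_inv_entry:
  assumes "invertible (M :: complex^'n^'n)"
  shows "matrix_inv M $ k $ j = det (\<chi> i l. if l = k then axis j 1 $ i else M $ i $ l) / det M"
proof -
  have "M *v (matrix_inv M *v axis j 1) = axis j 1"
    by (simp add: matrix_vector_mul_assoc matrix_inv_mult[OF assms])
  then have "matrix_inv M *v axis j 1 = (\<chi> k. det (\<chi> i l. if l = k then axis j 1 $ i else M $ i $ l) / det M)"
    using assms by (subst (asm) cramer) (simp_all add: invertible_det_nz)
  moreover have "(matrix_inv M *v axis j 1) $ k = matrix_inv M $ k $ j"
    by (simp add: matrix_vector_mult_def axis_def if_distrib cong: if_cong)
  ultimately show ?thesis
    by simp
qed

lemma continuous_on_matrix_inv:
  fixes F :: "'a::topological_space \<Rightarrow> complex^'n^'n"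
  assumes F: "continuous_on S F" and inv: "\<And>x. x \<in> S \<Longrightarrow> invertible (F x)"
  shows "continuous_on S (\<lambda>x. matrix_inv (F x))"
proof -
  have "continuous_on S (\<lambda>x. \<chi> k j. det (\<chi> i l. if l = k then axis j 1 $ i else F x $ i $ l) / det (F x))"
  proof (intro continuous_on_vec_lambda continuous_on_divide continuous_on_det F)
    show "continuous_on S (\<lambda>x. if l = k then axis j 1 $ i else F x $ i $ l)" for l k i j
      using F by (cases "l = k") (auto intro!: continuous_intros)
    show "\<forall>x\<in>S. det (F x) \<noteq> 0"
      using inv invertible_det_nz by blast
  qed
  then show ?thesis
    by (rule continuous_on_eq) (simp add: vec_eq_iff matrix_inv_entry inv)
qed

lemma slope_le_trace:
  assumes "psd P" "psd N" "0 \<le> \<kappa>" "0 \<le> \<kappa>t"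
  shows "slope P N B \<kappa> \<kappa>t \<le> Re (trace P)"
proof -
  have "psd (schur P N B \<kappa> \<kappa>t - mat 1)"
    unfolding schur_def using assms
    by (simp add: psd_add psd_scaleR psd_congruence[OF pos_def_imp_psd[OF pos_def_inv[OF pos_def_one_plus]]])
  from trace_psd_psd[OF matrix_inv_antitone(1)[OF pos_def_mat_1 this] assms(1)]
  show ?thesis
    by (simp add: slope_def matrix_diff_rdist trace_sub matrix_inv_eqI[of "mat 1" "mat 1"])
qed

text \<open>A critical point is a fixed point of the map that sends \<open>(\<kappa>, \<kappa>t)\<close> to the two slopes divided by \<open>\<tau>\<close>.
  This map is continuous for nonnegative arguments and takes values in the box \<open>S\<close>, since both Schur
  complements are at least the identity; the slopes are positive, hence so are the coordinates of the fixed point.\<close>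

lemma stationary_exists:
  assumes P: "psd P" "P \<noteq> 0" and N: "psd N" "N \<noteq> 0" and "0 < \<tau>"
  obtains \<kappa> \<kappa>t where "0 < \<kappa>" "0 < \<kappa>t" "stationary P N B \<tau> \<kappa> \<kappa>t"
proof -
  define S where "S = cbox (0, 0) (Re (trace N) / \<tau>, Re (trace P) / \<tau>)"
  define f where "f z = (slope N P (B\<^sup>H) (snd z) (fst z) / \<tau>, slope P N B (fst z) (snd z) / \<tau>)" for z
  have S: "z \<in> S \<longleftrightarrow> 0 \<le> fst z \<and> fst z \<le> Re (trace N) / \<tau> \<and> 0 \<le> snd z \<and> snd z \<le> Re (trace P) / \<tau>" for z
    by (cases z) (auto simp: S_def cbox_Pair_eq)
  have "(0, 0) \<in> S"
    using psd_trace_nonneg[OF P(1)] psd_trace_nonneg[OF N(1)] \<open>0 < \<tau>\<close> by (simp add: S)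
  have cont: "continuous_on S (\<lambda>z. schur P' N' B' (k z) (k' z))"
    if "psd P'" "psd N'" "continuous_on S k" "continuous_on S k'" "\<And>z. z \<in> S \<Longrightarrow> 0 \<le> k z \<and> 0 \<le> k' z"
    for P' :: "complex^'n^'n" and N' :: "complex^'m^'m" and B' and k k' :: "real \<times> real \<Rightarrow> real"
    unfolding schur_def using that
    by (intro continuous_intros continuous_on_matrix_mult continuous_on_matrix_inv
        pos_def_invertible pos_def_one_plus) auto
  have cont_slope: "continuous_on S (\<lambda>z. slope P' N' B' (k z) (k' z))"
    if "psd P'" "psd N'" "continuous_on S k" "continuous_on S k'" "\<And>z. z \<in> S \<Longrightarrow> 0 \<le> k z \<and> 0 \<le> k' z"
    for P' :: "complex^'n^'n" and N' :: "complex^'m^'m" and B' and k k' :: "real \<times> real \<Rightarrow> real"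
  proof -
    have "continuous_on S (\<lambda>z. matrix_inv (schur P' N' B' (k z) (k' z)) ** P')"
      using that by (intro continuous_on_matrix_mult continuous_on_matrix_inv cont continuous_on_const
          pos_def_invertible schur_pos_def) auto
    then show ?thesis
      unfolding slope_def trace_def by (intro continuous_intros)
  qed
  have "continuous_on S f"
    unfolding f_def using P N S \<open>0 < \<tau>\<close>
    by (intro continuous_on_Pair continuous_on_divide cont_slope continuous_on_const continuous_on_fst
        continuous_on_snd continuous_on_id) auto
  moreover have "f \<in> S \<rightarrow> S"
  proof
    fix z assume "z \<in> S"
    then have "0 \<le> fst z" "0 \<le> snd z" by (simp_all add: S)
    then show "f z \<in> S"
      using P N \<open>0 < \<tau>\<close> by (simp add: S f_def divide_right_mono slope_nonneg slope_le_trace)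
  qed
  moreover have "compact S" "convex S"
    by (simp_all add: S_def convex_box)
  moreover have "S \<noteq> {}"
    using \<open>(0, 0) \<in> S\<close> by blast
  ultimately obtain z where z: "z \<in> S" "f z = z"
    using brouwer by blast
  then have nn: "0 \<le> fst z" "0 \<le> snd z" and e: "fst z = slope N P (B\<^sup>H) (snd z) (fst z) / \<tau>"
    "snd z = slope P N B (fst z) (snd z) / \<tau>"
    by (simp_all add: S) (simp_all add: f_def prod_eq_iff)
  have "0 < fst z" "0 < snd z"
    using P N nn \<open>0 < \<tau>\<close> by (subst e, simp add: slope_pos)+
  moreover have "stationary P N B \<tau> (fst z) (snd z)"
    using e \<open>0 < \<tau>\<close> by (simp add: stationary_def field_simps)
  ultimately show ?thesis
    by (rule that)
qed

section \<open>Concavity of the log-determinant and of the parallel sum\<close>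

text \<open>Besides concavity this contains monotonicity: \<open>X0\<close> need only dominate the convex combination. The tangent
  inequalities at \<open>X0\<close> are averaged.\<close>

lemma log_det_concave:
  fixes X0 X1 X2 :: "complex^'n^'n"
  assumes pd: "pos_def X0" "pos_def X1" "pos_def X2" and u: "0 < u" "u < 1"
    and le: "psd (X0 - ((1 - u) *\<^sub>R X1 + u *\<^sub>R X2))"
  shows "(1 - u) * log_det X1 + u * log_det X2 \<le> log_det X0"
    and "X1 \<noteq> X2 \<Longrightarrow> (1 - u) * log_det X1 + u * log_det X2 < log_det X0"
proof -
  define l where "l X = Re (trace (matrix_inv X0 ** (X - X0)))" for X
  have "(1 - u) * l X1 + u * l X2
      = - Re (trace (matrix_inv X0 ** (X0 - ((1 - u) *\<^sub>R X1 + u *\<^sub>R X2))))"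
    by (simp add: l_def mat_distribs trace_add trace_sub trace_scaleR algebra_simps)
  then have sum: "(1 - u) * l X1 + u * l X2 \<le> 0"
    using trace_psd_psd[OF pos_def_imp_psd[OF pos_def_inv[OF pd(1)]] le] by simp
  have t: "log_det X1 \<le> log_det X0 + l X1" "log_det X2 \<le> log_det X0 + l X2"
    using log_det_tangent(1)[OF pd(1,2)] log_det_tangent(1)[OF pd(1,3)] by (simp_all add: l_def)
  have w: "(1 - u) * log_det X1 \<le> (1 - u) * (log_det X0 + l X1)"
    "u * log_det X2 \<le> u * (log_det X0 + l X2)"
    using t u by (simp_all add: mult_left_mono)
  have e: "(1 - u) * (log_det X0 + l X1) + u * (log_det X0 + l X2)
      = log_det X0 + ((1 - u) * l X1 + u * l X2)"
    by (simp add: algebra_simps)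
  show "(1 - u) * log_det X1 + u * log_det X2 \<le> log_det X0"
    using w e sum by linarith
  assume "X1 \<noteq> X2"
  then consider "X1 \<noteq> X0" | "X2 \<noteq> X0" by auto
  then show "(1 - u) * log_det X1 + u * log_det X2 < log_det X0"
  proof cases
    case 1
    from log_det_tangent(2)[OF pd(1,2) this] have "(1 - u) * log_det X1 < (1 - u) * (log_det X0 + l X1)"
      using u by (simp add: l_def)
    then show ?thesis using w e sum by linarith
  next
    case 2
    from log_det_tangent(2)[OF pd(1,3) this] have "u * log_det X2 < u * (log_det X0 + l X2)"
      using u by (simp add: l_def)
    then show ?thesis using w e sum by linarith
  qed
qed

text \<open>For invertible \<open>Q\<close> this is \<open>(F\<^sup>-\<^sup>1 + Q\<^sup>-\<^sup>1)\<^sup>-\<^sup>1\<close>. The formula chosen here also covers singular \<open>Q\<close>.\<close>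

definition parallel_sum :: "complex^'n^'n \<Rightarrow> complex^'n^'n \<Rightarrow> complex^'n^'n"
  where "parallel_sum F Q = Q - Q ** matrix_inv (F + Q) ** Q"

text \<open>Completion of the square. It exhibits the parallel sum as the minimum over \<open>Y\<close> of an expression that is
  affine in \<open>Q\<close>, attained at \<open>Y = (F + Q)\<^sup>-\<^sup>1 Q\<close>.\<close>

lemma parallel_sum_variational:
  assumes F: "pos_def F" and Q: "psd Q"
  shows "(mat 1 - Y)\<^sup>H ** Q ** (mat 1 - Y) + Y\<^sup>H ** F ** Y - parallel_sum F Q
    = (Y - matrix_inv (F + Q) ** Q)\<^sup>H ** (F + Q) ** (Y - matrix_inv (F + Q) ** Q)"
proof -
  define W V where "W = F + Q" and "V = matrix_inv W"
  have W: "pos_def W"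
    unfolding W_def by (rule pos_def_add[OF F Q])
  have V: "W ** V = mat 1" "V ** W = mat 1" "V\<^sup>H = V"
    using matrix_inv_mult[OF pos_def_invertible[OF W]] pos_def_ctranspose[OF pos_def_inv[OF W]]
    by (simp_all add: V_def)
  have QH: "Q\<^sup>H = Q"
    by (rule psd_ctranspose[OF Q])
  have WV: "Z ** W ** V = Z" "Z ** V ** W = Z" for Z
    using V by (metis matrix_mul_assoc matrix_mul_rid)+
  have "(Y - V ** Q)\<^sup>H ** W ** (Y - V ** Q) = Y\<^sup>H ** W ** Y - Y\<^sup>H ** Q - Q ** Y + Q ** V ** Q"
    by (simp add: ctranspose_mult V QH mat_distribs WV)
  moreover have "(mat 1 - Y)\<^sup>H ** Q ** (mat 1 - Y) + Y\<^sup>H ** F ** Y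
      = Q - Y\<^sup>H ** Q - Q ** Y + Y\<^sup>H ** W ** Y"
    by (simp add: W_def mat_distribs)
  ultimately show ?thesis
    by (simp add: parallel_sum_def V_def W_def)
qed

lemma parallel_sum_psd:
  assumes "pos_def F" "psd Q"
  shows "psd (parallel_sum F Q)"
proof -
  define Y where "Y = matrix_inv (F + Q) ** Q"
  have "parallel_sum F Q = (mat 1 - Y)\<^sup>H ** Q ** (mat 1 - Y) + Y\<^sup>H ** F ** Y"
    using parallel_sum_variational[OF assms, of Y] by (simp add: Y_def)
  then show ?thesis
    by (simp only:)
      (intro psd_add psd_congruence[OF assms(2)] psd_congruence[OF pos_def_imp_psd[OF assms(1)]])
qed

text \<open>A minimum of affine functions is concave: use for both \<open>Q1\<close> and \<open>Q2\<close> the matrix \<open>Y\<close> that is optimal for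
  their convex combination.\<close>

lemma parallel_sum_concave:
  assumes F: "pos_def F" and Q: "psd Q1" "psd Q2" and u: "0 < u" "u < 1"
  shows "psd (parallel_sum F ((1 - u) *\<^sub>R Q1 + u *\<^sub>R Q2)
    - ((1 - u) *\<^sub>R parallel_sum F Q1 + u *\<^sub>R parallel_sum F Q2))"
proof -
  define Q0 where "Q0 = (1 - u) *\<^sub>R Q1 + u *\<^sub>R Q2"
  define Y where "Y = matrix_inv (F + Q0) ** Q0"
  define T where "T Q = (mat 1 - Y)\<^sup>H ** Q ** (mat 1 - Y) + Y\<^sup>H ** F ** Y" for Q
  have "psd Q0"
    unfolding Q0_def using Q u by (intro psd_add psd_scaleR) auto
  then have 0: "parallel_sum F Q0 = T Q0"
    using parallel_sum_variational[OF F, of Q0 Y] by (simp add: T_def Y_def)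
  have T: "psd (T Q - parallel_sum F Q)" if "psd Q" for Q
    unfolding T_def parallel_sum_variational[OF F that]
    by (intro psd_congruence pos_def_imp_psd pos_def_add[OF F that])
  have "T Q0 = (1 - u) *\<^sub>R T Q1 + u *\<^sub>R T Q2"
    by (simp add: T_def Q0_def mat_distribs algebra_simps)
  then have "parallel_sum F Q0 - ((1 - u) *\<^sub>R parallel_sum F Q1 + u *\<^sub>R parallel_sum F Q2)
      = (1 - u) *\<^sub>R (T Q1 - parallel_sum F Q1) + u *\<^sub>R (T Q2 - parallel_sum F Q2)"
    by (simp add: 0 scaleR_diff_right)
  then show ?thesis
    unfolding Q0_def[symmetric] using T Q u by (simp only:) (intro psd_add psd_scaleR; simp)
qed

definition correlation :: "real \<Rightarrow> complex^'t^'t \<Rightarrow> complex^'t^'t \<Rightarrow> complex^'t^'t"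
  where "correlation b Ct Q = b *\<^sub>R (psd_sqrt Q ** Ct ** psd_sqrt Q)"

definition line_of_sight :: "real \<Rightarrow> complex^'t^'r \<Rightarrow> complex^'t^'t \<Rightarrow> complex^'t^'r"
  where "line_of_sight c A Q = c *\<^sub>R (A ** psd_sqrt Q)"

lemma correlation_psd:
  assumes "psd Q" "pos_def Ct" "0 < b"
  shows "psd (correlation b Ct Q)"
  using psd_congruence[OF pos_def_imp_psd[OF assms(2)], of "psd_sqrt Q"] assms
  by (simp add: correlation_def psd_scaleR psd_sqrt psd_ctranspose)

text \<open>This excludes the degenerate case in which the second equation of the canonical system would force
  its left-hand side to be 0.\<close>

lemma correlation_nonzero:
  assumes Q: "psd Q" "Q \<noteq> 0" and Ct: "pos_def Ct" and b: "0 < b"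
  shows "correlation b Ct Q \<noteq> 0"
proof
  define R where "R = psd_sqrt Q"
  have R: "R\<^sup>H = R" "R ** R = Q"
    using psd_sqrt[OF Q(1)] by (simp_all add: R_def psd_ctranspose)
  assume "correlation b Ct Q = 0"
  then have "R\<^sup>H ** Ct ** R = 0"
    using b R by (simp add: correlation_def R_def)
  then have "(R *v x) \<bullet> (Ct *v (R *v x)) = 0" for x
    using inner_congruence[of x R Ct] by simp
  then have "R *v x = 0" for x
    using Ct by (metis pos_def_iff less_irrefl)
  then have "R = 0"
    by (simp add: matrix_zero_iff)
  with R Q(2) show False by simp
qed

text \<open>With \<open>F\<close> the inverse of \<open>\<kappa> b Ct\<close> the square root of \<open>Q\<close> disappears from the energy: \<open>det(1 + \<kappa> P)\<close>
  becomes a multiple of \<open>det(F + Q)\<close>, and \<open>R (1 + \<kappa> P)\<^sup>-\<^sup>1 R\<close> is the parallel sum of \<open>F\<close> and \<open>Q\<close>.\<close>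

lemma energy_parallel_sum:
  fixes A :: "complex^'t^'r" and Ct Q :: "complex^'t^'t"
  assumes Q: "psd Q" and Ct: "pos_def Ct" and N: "psd N" and pos: "0 < b" "0 < \<kappa>" "0 \<le> \<kappa>t"
  defines "F \<equiv> matrix_inv ((\<kappa> * b) *\<^sub>R Ct)"
  shows "energy (correlation b Ct Q) N (line_of_sight c A Q) \<kappa> \<kappa>t
    = log_det (mat 1 + \<kappa>t *\<^sub>R N + (c *\<^sub>R A) ** parallel_sum F Q ** (c *\<^sub>R A)\<^sup>H)
      + (log_det (F + Q) + log_det ((\<kappa> * b) *\<^sub>R Ct))"
proof -
  define R where "R = psd_sqrt Q"
  have R: "R\<^sup>H = R" "R ** R = Q"
    using psd_sqrt[OF Q] by (simp_all add: R_def psd_ctranspose)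
  define M where "M = (\<kappa> * b) *\<^sub>R Ct"
  have M: "pos_def M"
    unfolding M_def using Ct pos by (intro pos_def_scaleR) auto
  have FM: "F ** M = mat 1" "M ** F = mat 1" and F: "pos_def F"
    using matrix_inv_mult[OF pos_def_invertible[OF M]] pos_def_inv[OF M] by (simp_all add: F_def M_def)
  have FQ: "pos_def (F + Q)"
    by (rule pos_def_add[OF F Q])
  note iFQ = matrix_inv_mult[OF pos_def_invertible[OF FQ]]
  have \<kappa>P: "\<kappa> *\<^sub>R correlation b Ct Q = R ** M ** R"
    by (simp add: correlation_def R_def M_def mat_distribs)
  have J: "pos_def (mat 1 + R ** M ** R)"
    using pos_def_add[OF pos_def_mat_1 psd_congruence[OF pos_def_imp_psd[OF M], of R]] R by simp
  note iJ = matrix_inv_mult[OF pos_def_invertible[OF J]]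
  \<comment> \<open>The factor \<open>R\<close> is moved through the inverse, using \<open>1 + M Q = M (F + Q)\<close>.\<close>
  have "(mat 1 + R ** M ** R) ** (R ** matrix_inv (F + Q) ** F) = R ** M ** ((F + Q) ** matrix_inv (F + Q)) ** F"
  proof -
    have "(mat 1 + R ** M ** R) ** R = R ** M ** (F + Q)"
      using FM(2) R(2) by (simp add: mat_distribs) (metis matrix_mul_assoc matrix_mul_rid)
    then show ?thesis
      by (simp only: matrix_mul_assoc)
  qed
  also have "\<dots> = R ** (M ** F)"
    by (simp only: iFQ matrix_mul_rid matrix_mul_assoc)
  finally have "(mat 1 + R ** M ** R) ** (R ** matrix_inv (F + Q) ** F) = R"
    by (simp add: FM)
  then have "matrix_inv (mat 1 + R ** M ** R) ** R = R ** matrix_inv (F + Q) ** F"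
    using iJ(2) by (metis matrix_mul_assoc matrix_mul_lid)
  then have "R ** matrix_inv (mat 1 + R ** M ** R) ** R = Q ** matrix_inv (F + Q) ** F"
    using R(2) by (metis matrix_mul_assoc)
  also have "\<dots> = Q ** (matrix_inv (F + Q) ** ((F + Q) - Q))"
    by (simp add: matrix_mul_assoc)
  also have "\<dots> = parallel_sum F Q"
    unfolding matrix_diff_ldist iFQ parallel_sum_def by (simp add: matrix_mul_assoc)
  finally have par: "R ** matrix_inv (mat 1 + R ** M ** R) ** R = parallel_sum F Q" .
  have 1: "schur N (correlation b Ct Q) ((line_of_sight c A Q)\<^sup>H) \<kappa>t \<kappa>
      = mat 1 + \<kappa>t *\<^sub>R N + (c *\<^sub>R A) ** parallel_sum F Q ** (c *\<^sub>R A)\<^sup>H"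
    unfolding schur_def \<kappa>P par[symmetric]
    by (simp add: line_of_sight_def R_def[symmetric] ctranspose_mult R(1) mat_distribs)
  have 2: "log_det (mat 1 + \<kappa> *\<^sub>R correlation b Ct Q) = log_det (F + Q) + log_det M"
  proof (rule log_det_mult[OF FQ M])
    obtain E where E: "psd E" "E ** E = M"
      using psd_sqrt_exists[OF pos_def_imp_psd[OF M]] .
    note EH = psd_ctranspose[OF E(1)]
    have "E ** (E ** F) = mat 1"
      using FM E by (simp add: matrix_mul_assoc)
    then have EFE: "E ** F ** E = mat 1"
      using matrix_left_right_inverse by blast
    have "det (mat 1 + R ** M ** R) = det (mat 1 + (E ** R)\<^sup>H ** (E ** R))"
      by (simp add: ctranspose_mult EH R E(2)[symmetric] matrix_mul_assoc)
    also have "\<dots> = det (mat 1 + (E ** R) ** (E ** R)\<^sup>H)"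
      by (rule det_gram_swap)
    also have "\<dots> = det (E ** (F + Q) ** E)"
      by (simp add: ctranspose_mult EH R(1) R(2)[symmetric] EFE mat_distribs)
    also have "\<dots> = det (F + Q) * det M"
      by (simp add: E(2)[symmetric] det_mul)
    finally show "det (mat 1 + \<kappa> *\<^sub>R correlation b Ct Q) = det (F + Q) * det M"
      by (simp only: \<kappa>P)
  qed
  have "energy (correlation b Ct Q) N (line_of_sight c A Q) \<kappa> \<kappa>t
      = energy N (correlation b Ct Q) ((line_of_sight c A Q)\<^sup>H) \<kappa>t \<kappa>"
    using correlation_psd[OF Q Ct pos(1)] N pos by (intro energy_swap) auto
  then show ?thesis
    by (simp only: energy_def 1 2 M_def)
qed

text \<open>For fixed \<open>\<kappa>\<close> the energy is jointly concave in \<open>(\<kappa>t, Q)\<close>. The strictness comes from the term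
  \<open>log det(F + Q)\<close>.\<close>

lemma energy_strictly_concave:
  fixes A :: "complex^'t^'r" and Ct Q1 Q2 :: "complex^'t^'t" and b c :: real
  assumes Q: "psd Q1" "psd Q2" "Q1 \<noteq> Q2" and Ct: "pos_def Ct" and N: "psd N"
    and pos: "0 < b" "0 < \<kappa>" "0 \<le> k1" "0 \<le> k2" and u: "0 < u" "u < 1"
  defines "f \<equiv> \<lambda>Q. energy (correlation b Ct Q) N (line_of_sight c A Q) \<kappa>"
  shows "(1 - u) * f Q1 k1 + u * f Q2 k2
    < f ((1 - u) *\<^sub>R Q1 + u *\<^sub>R Q2) ((1 - u) * k1 + u * k2)"
proof -
  define M where "M = (\<kappa> * b) *\<^sub>R Ct"
  define F where "F = matrix_inv M"
  define X where "X k Q = mat 1 + k *\<^sub>R N + (c *\<^sub>R A) ** parallel_sum F Q ** (c *\<^sub>R A)\<^sup>H" for k Q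
  define Q0 where "Q0 = (1 - u) *\<^sub>R Q1 + u *\<^sub>R Q2"
  define k0 where "k0 = (1 - u) * k1 + u * k2"
  have F: "pos_def F"
    unfolding F_def M_def using Ct pos by (intro pos_def_inv pos_def_scaleR) auto
  have Q0: "psd Q0"
    unfolding Q0_def using Q u by (intro psd_add psd_scaleR) auto
  have k0: "0 \<le> k0"
    unfolding k0_def using pos u by simp
  have f: "f Q k = log_det (X k Q) + (log_det (F + Q) + log_det M)" if "psd Q" "0 \<le> k" for Q k
    unfolding f_def X_def F_def M_def by (rule energy_parallel_sum) (use that Ct N pos in auto)
  have X: "pos_def (X k Q)" if "psd Q" "0 \<le> k" for Q k
    unfolding X_def
    using psd_congruence[OF parallel_sum_psd[OF F that(1)], of "(c *\<^sub>R A)\<^sup>H"] that N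
    by (intro pos_def_add[OF pos_def_one_plus]) auto
  have "X k0 Q0 - ((1 - u) *\<^sub>R X k1 Q1 + u *\<^sub>R X k2 Q2) = (c *\<^sub>R A) **
      (parallel_sum F Q0 - ((1 - u) *\<^sub>R parallel_sum F Q1 + u *\<^sub>R parallel_sum F Q2)) ** (c *\<^sub>R A)\<^sup>H"
    by (simp add: X_def k0_def mat_distribs algebra_simps)
  then have "psd (X k0 Q0 - ((1 - u) *\<^sub>R X k1 Q1 + u *\<^sub>R X k2 Q2))"
    using psd_congruence[OF parallel_sum_concave[OF F Q(1,2) u], of "(c *\<^sub>R A)\<^sup>H"] by (simp add: Q0_def)
  from log_det_concave(1)[OF X X X u this] 
  have 1: "(1 - u) * log_det (X k1 Q1) + u * log_det (X k2 Q2) \<le> log_det (X k0 Q0)"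
    using Q Q0 pos k0 by simp
  have "F + Q0 - ((1 - u) *\<^sub>R (F + Q1) + u *\<^sub>R (F + Q2)) = 0"
    by (simp add: Q0_def algebra_simps)
  then have "psd (F + Q0 - ((1 - u) *\<^sub>R (F + Q1) + u *\<^sub>R (F + Q2)))"
    by (simp add: psd_zero)
  from log_det_concave(2)[OF pos_def_add[OF F Q0] pos_def_add[OF F Q(1)] pos_def_add[OF F Q(2)] u this]
  have 2: "(1 - u) * log_det (F + Q1) + u * log_det (F + Q2) < log_det (F + Q0)"
    using Q(3) by simp
  have "(1 - u) * f Q1 k1 + u * f Q2 k2 = ((1 - u) * log_det (X k1 Q1) + u * log_det (X k2 Q2))
      + ((1 - u) * log_det (F + Q1) + u * log_det (F + Q2)) + log_det M"
    using f Q pos by (simp add: algebra_simps)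
  also have "\<dots> < log_det (X k0 Q0) + (log_det (F + Q0) + log_det M)"
    using 1 2 by linarith
  also have "\<dots> = f Q0 k0"
    using f Q0 k0 by simp
  finally show ?thesis
    unfolding Q0_def k0_def .
qed

section \<open>The canonical system and the concavity of the mutual information\<close>

lemma trace_ctranspose: "trace (M\<^sup>H) = cnj (trace M)"
  by (simp add: trace_def ctranspose_def)

text \<open>The traces in the canonical system are real, so each of its complex equations amounts to a real one.\<close>

lemma trace_hermitian_product:
  fixes M N :: "complex^'n^'n"
  assumes "M\<^sup>H = M" "N\<^sup>H = N"
  shows "trace (N ** M) = of_real (Re (trace (M ** N)))"
proof -
  have "cnj (trace (M ** N)) = trace (M ** N)"
    using trace_ctranspose[of "M ** N"] assms trace_mul_sym[of N M] by (simp add: ctranspose_mult)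
  then show ?thesis
    by (simp add: trace_mul_sym[of N M] complex_eq_iff)
qed

lemma trace_scaled_inverse:
  fixes M G :: "complex^'n^'n"
  assumes "pos_def M" "G\<^sup>H = G" "s \<noteq> 0"
  shows "trace (G ** matrix_inv (s *\<^sub>R M)) = of_real (Re (trace (matrix_inv M ** G)) / s)"
  using trace_hermitian_product[OF pos_def_ctranspose[OF pos_def_inv[OF assms(1)]] assms(2)]
  by (simp add: matrix_inv_scaleR[OF pos_def_invertible[OF assms(1)] assms(3)] mat_distribs trace_scaleR
      scaleR_conv_of_real[where 'a=complex])

text \<open>Here \<open>\<sigma>\<^sup>2\<close> times the Schur complements are the matrices inverted in the canonical system, and the scalars
  \<open>1 / (K + 1)\<close> and \<open>\<tau>\<close> absorb the remaining factors.\<close>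

lemma canonical_system_iff_stationary:
  fixes A :: "complex^'t^'r" and C :: "complex^'r^'r" and Ct Q :: "complex^'t^'t"
  assumes \<sigma>: "\<sigma>\<^sup>2 > 0" and K: "K \<ge> 0" and C: "pos_def C" and Ct: "pos_def Ct" and Q: "psd Q"
    and nonneg: "0 \<le> d" "0 \<le> dt"
  shows "canonical_system \<sigma> K A C Ct Q d dt \<longleftrightarrow>
    stationary (correlation (1 / (K + 1)) Ct Q) ((1 / (K + 1)) *\<^sub>R C)
      (line_of_sight (sqrt (K / (K + 1) / \<sigma>\<^sup>2)) A Q) (real CARD('t) * \<sigma>\<^sup>2 / (K + 1)) d dt"
proof -
  define R where "R = psd_sqrt Q"
  define b where "b = 1 / (K + 1)"
  define a where "a = K / (K + 1)"
  define c where "c = sqrt (a / \<sigma>\<^sup>2)"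
  define P where "P = correlation b Ct Q"
  define N where "N = b *\<^sub>R C"
  define B where "B = line_of_sight c A Q"
  define \<tau> where "\<tau> = real CARD('t) * \<sigma>\<^sup>2 / (K + 1)"
  have RH: "R\<^sup>H = R"
    using psd_sqrt[OF Q] by (simp add: R_def psd_ctranspose)
  have b: "0 < b" and a: "0 \<le> a"
    using K by (simp_all add: b_def a_def)
  have \<tau>: "\<tau> = real CARD('t) * \<sigma>\<^sup>2 * b"
    by (simp add: \<tau>_def b_def)
  have s0: "\<sigma>\<^sup>2 \<noteq> 0"
    using \<sigma> by simp
  have c2: "\<sigma>\<^sup>2 * (c * c) = a"
    using a \<sigma> by (simp add: c_def)
  have P: "psd P" and N: "psd N"
    unfolding P_def N_def using correlation_psd[OF Q Ct b] C b
    by (simp_all add: psd_scaleR pos_def_imp_psd)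
  have X: "pos_def (schur P N B d dt)" and Z: "pos_def (schur N P (B\<^sup>H) dt d)"
    using schur_pos_def P N nonneg by blast+
  have dP: "(d / (K + 1)) *\<^sub>R (R ** Ct ** R) = d *\<^sub>R P"
    by (simp add: P_def correlation_def R_def b_def)
  have dN: "(dt / (K + 1)) *\<^sub>R C = dt *\<^sub>R N"
    by (simp add: N_def b_def)
  have eX: "\<sigma>\<^sup>2 *\<^sub>R (mat 1 + d *\<^sub>R P) + a *\<^sub>R (R ** A\<^sup>H ** matrix_inv (mat 1 + dt *\<^sub>R N) ** A ** R)
      = \<sigma>\<^sup>2 *\<^sub>R schur P N B d dt"
    by (simp add: schur_def B_def line_of_sight_def R_def[symmetric] ctranspose_mult RH mat_distribs
        scaleR_add_right c2)
  have eZ: "\<sigma>\<^sup>2 *\<^sub>R (mat 1 + dt *\<^sub>R N) + a *\<^sub>R (A ** R ** matrix_inv (mat 1 + d *\<^sub>R P) ** R ** A\<^sup>H)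
      = \<sigma>\<^sup>2 *\<^sub>R schur N P (B\<^sup>H) dt d"
    by (simp add: schur_def B_def line_of_sight_def R_def[symmetric] ctranspose_mult RH mat_distribs
        scaleR_add_right c2)
  have GH: "(R ** Ct ** R)\<^sup>H = R ** Ct ** R"
    by (simp add: ctranspose_mult RH pos_def_ctranspose[OF Ct] matrix_mul_assoc)
  have sX: "Re (trace (matrix_inv (schur P N B d dt) ** (R ** Ct ** R))) = slope P N B d dt / b"
    using b by (simp add: slope_def P_def correlation_def R_def matrix_scaleR_right trace_scaleR)
  have sZ: "Re (trace (matrix_inv (schur N P (B\<^sup>H) dt d) ** C)) = slope N P (B\<^sup>H) dt d / b"
    using b by (simp add: slope_def N_def matrix_scaleR_right trace_scaleR)
  have "canonical_system \<sigma> K A C Ct Q d dt \<longleftrightarrow>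
      complex_of_real d = of_real (slope N P (B\<^sup>H) dt d / b / \<sigma>\<^sup>2) / of_nat CARD('t) \<and>
      complex_of_real dt = of_real (slope P N B d dt / b / \<sigma>\<^sup>2) / of_nat CARD('t)"
    unfolding canonical_system_def Let_def R_def[symmetric] a_def[symmetric] dP dN eX eZ
    by (simp only: trace_scaled_inverse[OF X GH s0] sX sZ
        trace_scaled_inverse[OF Z pos_def_ctranspose[OF C] s0])
  also have "\<dots> \<longleftrightarrow> d = slope N P (B\<^sup>H) dt d / \<tau> \<and> dt = slope P N B d dt / \<tau>"
  proof -
    have "complex_of_real (x / b / \<sigma>\<^sup>2) / of_nat CARD('t) = of_real (x / \<tau>)" for x
      by (simp add: \<tau> ac_simps)
    then show ?thesis
      by (simp only: of_real_eq_iff)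
  qed
  also have "\<dots> \<longleftrightarrow> stationary P N B \<tau> d dt"
    using b \<sigma> by (auto simp: stationary_def \<tau> field_simps)
  finally show ?thesis
    by (simp only: P_def N_def B_def c_def a_def b_def \<tau>_def)
qed

lemma psd_convex: "psd M \<Longrightarrow> psd N \<Longrightarrow> 0 \<le> u \<Longrightarrow> u \<le> 1 \<Longrightarrow> psd ((1 - u) *\<^sub>R M + u *\<^sub>R N)"
  by (intro psd_add psd_scaleR) auto

lemma convex_C1: "convex (C1 :: (complex^'t^'t) set)"
  unfolding convex_alt
proof (intro ballI allI impI)
  fix X Y :: "complex^'t^'t" and u :: real
  assume "X \<in> C1" "Y \<in> C1" "0 \<le> u \<and> u \<le> 1"
  then show "(1 - u) *\<^sub>R X + u *\<^sub>R Y \<in> C1"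
    by (auto simp: C1_def psd_convex trace_add trace_scaleR scaleR_conv_of_real[where 'a=complex]
        simp flip: distrib_right)
qed

theorem theorem4:
  fixes \<sigma> K :: real
    and A :: "complex^'t^'r"
    and C :: "complex^'r^'r"
    and Ct :: "complex^'t^'t"
  assumes "\<sigma>\<^sup>2 > 0"
    and "K \<ge> 0"
    and "trace (A ** A\<^sup>H) / of_nat CARD('r) = 1"
    and "pos_def C"
    and "pos_def Ct"
    and "trace C / of_nat CARD('r) = 1"
    and "trace Ct / of_nat CARD('t) = 1"
  shows "strictly_concave_on C1 (I_bar \<sigma> K A C Ct)"
proof -
  define b where "b = 1 / (K + 1)"
  define c where "c = sqrt (K / (K + 1) / \<sigma>\<^sup>2)"
  define N where "N = b *\<^sub>R C"
  define \<tau> where "\<tau> = real CARD('t) * \<sigma>\<^sup>2 / (K + 1)"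
  define P where "P = correlation b Ct"
  define B where "B = line_of_sight c A"
  define V where "V Q k kt = energy (P Q) N (B Q) k kt - \<tau> * k * kt" for Q k kt
  have b: "0 < b" and \<tau>: "0 < \<tau>"
    using assms(1,2) by (simp_all add: b_def \<tau>_def)
  have C: "pos_def C" and Ct: "pos_def Ct"
    using assms by auto
  have N: "psd N" "N \<noteq> 0"
  proof -
    have "pos_def N"
      unfolding N_def by (intro pos_def_scaleR C b)
    moreover have "\<not> pos_def (0 :: complex^'r^'r)"
      using axis_eq_0_iff[of undefined "1::complex"] by (auto simp: pos_def_iff)
    ultimately show "psd N" "N \<noteq> 0"
      using pos_def_imp_psd by auto
  qed
  have P: "psd (P Q)" "P Q \<noteq> 0" if "psd Q" "Q \<noteq> 0" for Q
    unfolding P_def using correlation_psd[OF that(1) Ct b] correlation_nonzero[OF that Ct b] by auto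
  have C1: "psd Q" "Q \<noteq> 0" if "Q \<in> C1" for Q :: "complex^'t^'t"
    using that by (auto simp: C1_def trace_0[unfolded mat_0])
  have sol: "\<exists>k kt. 0 < k \<and> 0 < kt \<and> stationary (P Q) N (B Q) \<tau> k kt \<and> I_bar \<sigma> K A C Ct Q = V Q k kt"
    if "Q \<in> C1" for Q
  proof -
    note Q = C1[OF that]
    obtain k kt where k: "0 < k" "0 < kt" and st: "stationary (P Q) N (B Q) \<tau> k kt"
      using stationary_exists[OF P[OF Q] N \<tau>] .
    have iff: "canonical_system \<sigma> K A C Ct Q d dt \<longleftrightarrow> stationary (P Q) N (B Q) \<tau> d dt"
      if "0 < d" "0 < dt" for d dt
      using canonical_system_iff_stationary[OF assms(1,2) C Ct Q(1), of d dt A] that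
      by (simp add: P_def N_def B_def c_def b_def \<tau>_def)
    have "delta_pair \<sigma> K A C Ct Q = (k, kt)"
      unfolding delta_pair_def
    proof (rule the_equality)
      show "0 < fst (k, kt) \<and> 0 < snd (k, kt) \<and> canonical_system \<sigma> K A C Ct Q (fst (k, kt)) (snd (k, kt))"
        using k st iff by simp
      show "p = (k, kt)"
        if "0 < fst p \<and> 0 < snd p \<and> canonical_system \<sigma> K A C Ct Q (fst p) (snd p)" for p
      proof -
        have "stationary (P Q) N (B Q) \<tau> (fst p) (snd p)"
          using that iff[of "fst p" "snd p"] by blast
        with stationary_unique[OF P[OF Q] N _ _ k _ st, of "fst p" "snd p"] that show ?thesis
          by (simp add: prod_eq_iff)
      qed
    qed
    moreover have "(psd_sqrt Q)\<^sup>H = psd_sqrt Q"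
      by (rule psd_ctranspose[OF psd_sqrt(1)[OF Q(1)]])
    moreover have "c * c = 1 / \<sigma>\<^sup>2 * (K / (K + 1))"
      using assms(1,2) by (simp add: c_def)
    ultimately have "I_bar \<sigma> K A C Ct Q = V Q k kt"
      by (simp add: I_bar_def Let_def V_def energy_def schur_def P_def N_def B_def b_def \<tau>_def correlation_def
          line_of_sight_def ctranspose_mult mat_distribs)
    with k st show ?thesis by blast
  qed
  show ?thesis
    unfolding strictly_concave_on_def
  proof (intro conjI ballI impI convex_C1)
    fix u :: real and Q1 Q2 :: "complex^'t^'t"
    assume "u \<in> {0<..<1}" and Q1: "Q1 \<in> C1" and Q2: "Q2 \<in> C1" and "Q1 \<noteq> Q2"
    then have u: "0 < u" "u < 1" by auto
    define Q0 where "Q0 = (1 - u) *\<^sub>R Q1 + u *\<^sub>R Q2"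
    have Q0: "Q0 \<in> C1"
      unfolding Q0_def using convex_C1[where 't='t] Q1 Q2 u by (simp add: convex_alt less_imp_le)
    obtain k kt where k: "0 < k" "0 < kt" "stationary (P Q0) N (B Q0) \<tau> k kt"
      and I0: "I_bar \<sigma> K A C Ct Q0 = V Q0 k kt"
      using sol[OF Q0] by blast
    \<comment> \<open>The critical point of \<open>Q\<close> is slid along its hyperbola to the abscissa \<open>k\<close> of the critical point
      of \<open>Q0\<close>.\<close>
    have upper: "\<exists>l>0. I_bar \<sigma> K A C Ct Q \<le> V Q k l" if Q: "Q \<in> C1" for Q
    proof -
      obtain d dt where d: "0 < d" "0 < dt" "stationary (P Q) N (B Q) \<tau> d dt"
        and I: "I_bar \<sigma> K A C Ct Q = V Q d dt"
        using sol[OF Q] by blast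
      have "V Q d dt \<le> V Q k (d * dt / k)"
        using energy_hyperbola[OF P[OF C1[OF Q]] N d(1,2) stationary_balanced[OF d(3)] k(1)] k
        by (simp add: V_def)
      then show ?thesis
        using I d k by (intro exI[of _ "d * dt / k"]) simp
    qed
    obtain k1 where k1: "0 < k1" "I_bar \<sigma> K A C Ct Q1 \<le> V Q1 k k1"
      using upper[OF Q1] by blast
    obtain k2 where k2: "0 < k2" "I_bar \<sigma> K A C Ct Q2 \<le> V Q2 k k2"
      using upper[OF Q2] by blast
    define k0 where "k0 = (1 - u) * k1 + u * k2"
    have "0 \<le> k0"
      using k1 k2 u by (simp add: k0_def)
    have "(1 - u) * I_bar \<sigma> K A C Ct Q1 + u * I_bar \<sigma> K A C Ct Q2 \<le> (1 - u) * V Q1 k k1 + u * V Q2 k k2"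
      using k1 k2 u by (intro add_mono mult_left_mono) auto
    also have "\<dots> = (1 - u) * energy (P Q1) N (B Q1) k k1 + u * energy (P Q2) N (B Q2) k k2 - \<tau> * k * k0"
      by (simp add: V_def k0_def algebra_simps)
    also have "\<dots> < V Q0 k k0"
      using energy_strictly_concave[OF C1(1)[OF Q1] C1(1)[OF Q2] \<open>Q1 \<noteq> Q2\<close> Ct N(1) b k(1) _ _ u, of k1 k2 c A] k1 k2
      by (simp add: V_def P_def B_def Q0_def k0_def)
    also have "\<dots> \<le> V Q0 k kt"
      using stationary_max(1)[OF P(1)[OF C1[OF Q0]] N(1) _ _ \<open>0 \<le> k0\<close> k(3)] k by (simp add: V_def)
    finally show "(1 - u) * I_bar \<sigma> K A C Ct Q1 + u * I_bar \<sigma> K A C Ct Q2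
        < I_bar \<sigma> K A C Ct ((1 - u) *\<^sub>R Q1 + u *\<^sub>R Q2)"
      using I0 by (simp add: Q0_def)
  qed
qed

end
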